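(* Let $V$ be a positive integer divisible by $4$, and write the prime factorization of $V/4$ as $$\frac{V}{4} = 3^{m}\, p_1^{k_1}\cdots p_r^{k_r}\, q_1^{\ell_1}\cdots q_s^{\ell_s},$$ where $p_1,\dots,p_r$ are distinct primes with $p_i\equiv 1\pmod 3$, $q_1,\dots,q_s$ are distinct primes with $q_j\equiv 2\pmod 3$, $m\ge 0$, and all $k_i\ge1$, $\ell_j\ge 1$. Let $\delta(V)$ be the number of trihexes with $V$ vertices that have 3-fold rotational symmetry. Then $\delta(V)=0$ if some $\ell_j$ is odd, and if all $\ell_j$ are even then $$\delta(V)=\prod_{i=1}^{r}(k_i+1).$$
   Context: A trihex is a 3-regular graph embedded in the plane (equivalently, in the sphere) all of whose faces, including the unbounded one, have exactly 3 or exactly 6 sides. Two trihexes are counted as the same if they are isomorphic as graphs via an isomorphism induced by an orientation-preserving homeomorphism of the plane (so a chiral trihex and its mirror image are distinct). A trihex has 3-fold rotational symmetry if it can be embedded on the sphere so that some rotation of the sphere of order 3 induces a graph automorphism of it. *)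

theory Defs
  imports
    "HOL-Computational_Algebra.Primes"
    "HOL-Combinatorics.Orbits"
    "Graph_Theory.Pair_Digraph"
    "Graph_Theory.Digraph_Component"
begin

text \<open>
  A finite connected graph embedded in an oriented closed surface with all faces open discs is
  determined, up to orientation-preserving homeomorphism, by its rotation system: the permutation
  of the darts (directed edges) that sends each dart to the next one, counterclockwise, with the
  same initial vertex (Heffter, Edmonds).  Embedded graphs are represented by this data.
\<close>

record 'a embedded_graph =
  skeleton :: "'a pair_pre_digraph"
  rot :: "'a \<times> 'a \<Rightarrow> 'a \<times> 'a"

definition rotation_system :: "'a embedded_graph \<Rightarrow> bool" where
  "rotation_system M \<longleftrightarrow>
     rot M permutes parcs (skeleton M) \<and>
     (\<forall>v \<in> pverts (skeleton M). out_arcs (skeleton M) v \<noteq> {} \<longrightarrow>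
        cyclic_on (rot M) (out_arcs (skeleton M) v))"

text \<open>
  Walking along the boundary of a face: traverse the dart \<open>(u, v)\<close>, then leave \<open>v\<close> by the dart
  that follows \<open>(v, u)\<close> in the rotation at \<open>v\<close>.  A face is the closed walk so obtained; its
  number of sides is the number of darts of this walk, so that an edge with the same face on
  both sides counts twice.
\<close>

definition face_succ :: "'a embedded_graph \<Rightarrow> 'a \<times> 'a \<Rightarrow> 'a \<times> 'a" where
  "face_succ M = rot M \<circ> prod.swap"

definition faces :: "'a embedded_graph \<Rightarrow> ('a \<times> 'a) set set" where
  "faces M = orbit (face_succ M) ` parcs (skeleton M)"

definition sides :: "('a \<times> 'a) set \<Rightarrow> nat" where
  "sides F = card F"

text \<open>Every undirected edge contributes two darts.\<close>

definition euler_char :: "'a embedded_graph \<Rightarrow> int" where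
  "euler_char M = int (card (pverts (skeleton M))) - int (card (parcs (skeleton M)) div 2)
     + int (card (faces M))"

text \<open>The sphere is the closed orientable surface of Euler characteristic 2.\<close>

definition plane_graph :: "'a embedded_graph \<Rightarrow> bool" where
  "plane_graph M \<longleftrightarrow>
     pair_graph (skeleton M) \<and> connected (skeleton M) \<and> rotation_system M \<and> euler_char M = 2"

definition regular :: "nat \<Rightarrow> 'a embedded_graph \<Rightarrow> bool" where
  "regular d M \<longleftrightarrow> (\<forall>v \<in> pverts (skeleton M). out_degree (skeleton M) v = d)"

definition trihex :: "'a embedded_graph \<Rightarrow> bool" where
  "trihex M \<longleftrightarrow> plane_graph M \<and> regular 3 M \<and> (\<forall>F \<in> faces M. sides F = 3 \<or> sides F = 6)"

text \<open>
  Graph isomorphisms that carry the rotation at each vertex to the rotation at its image, i.e.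
  those induced by an orientation-preserving homeomorphism of the sphere.
\<close>

definition oriented_iso :: "('a \<Rightarrow> 'b) \<Rightarrow> 'a embedded_graph \<Rightarrow> 'b embedded_graph \<Rightarrow> bool" where
  "oriented_iso f M N \<longleftrightarrow>
     bij_betw f (pverts (skeleton M)) (pverts (skeleton N)) \<and>
     map_prod f f ` parcs (skeleton M) = parcs (skeleton N) \<and>
     (\<forall>a \<in> parcs (skeleton M). map_prod f f (rot M a) = rot N (map_prod f f a))"

text \<open>
  A rotation of the sphere of order 3 that maps an embedded graph to itself induces an
  orientation-preserving automorphism of order 3; conversely, every such automorphism of a
  connected graph on the sphere is induced by a rotation in a suitable embedding.
\<close>

definition three_fold_symmetric :: "'a embedded_graph \<Rightarrow> bool" where
  "three_fold_symmetric M \<longleftrightarrow>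
     (\<exists>f. oriented_iso f M M \<and>
        (\<exists>v \<in> pverts (skeleton M). f v \<noteq> v) \<and>
        (\<forall>v \<in> pverts (skeleton M). (f ^^ 3) v = v))"

definition trihex_equiv :: "('a embedded_graph \<times> 'a embedded_graph) set" where
  "trihex_equiv = {(M, N). trihex M \<and> trihex N \<and> (\<exists>f. oriented_iso f M N)}"

lemma oriented_iso_comp:
  assumes "oriented_iso f M N" "oriented_iso g N K"
  shows "oriented_iso (g \<circ> f) M K"
proof -
  have comp: "map_prod (g \<circ> f) (g \<circ> f) = map_prod g g \<circ> map_prod f f"
    by (simp add: fun_eq_iff)
  have "map_prod g g (map_prod f f (rot M a)) = rot K (map_prod g g (map_prod f f a))"
    if "a \<in> parcs (skeleton M)" for a
    using that assms unfolding oriented_iso_def by (metis imageI)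
  moreover have "map_prod g g ` map_prod f f ` parcs (skeleton M) = parcs (skeleton K)"
    using assms unfolding oriented_iso_def by simp
  moreover have "bij_betw (g \<circ> f) (pverts (skeleton M)) (pverts (skeleton K))"
    using assms unfolding oriented_iso_def by (blast intro: bij_betw_trans)
  ultimately show ?thesis
    unfolding oriented_iso_def comp by (simp add: image_comp)
qed

lemma oriented_iso_inv:
  assumes "pair_graph (skeleton M)" "rotation_system M" "oriented_iso f M N"
  shows "oriented_iso (inv_into (pverts (skeleton M)) f) N M"
proof -
  interpret pair_graph "skeleton M" by fact
  let ?V = "pverts (skeleton M)" and ?A = "parcs (skeleton M)"
  let ?g = "inv_into ?V f"
  have bij: "bij_betw f ?V (pverts (skeleton N))"
    and arcs: "map_prod f f ` ?A = parcs (skeleton N)"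
    and rot: "\<And>a. a \<in> ?A \<Longrightarrow> map_prod f f (rot M a) = rot N (map_prod f f a)"
    using assms(3) unfolding oriented_iso_def by auto
  have inv: "map_prod ?g ?g (map_prod f f a) = a" if "a \<in> ?A" for a
    using arc_fst_in_verts[OF that] arc_snd_in_verts[OF that] bij
    by (cases a) (simp add: bij_betw_def)
  have img: "map_prod ?g ?g ` parcs (skeleton N) = ?A"
    using inv unfolding arcs[symmetric] image_image by simp
  have "map_prod ?g ?g (rot N b) = rot M (map_prod ?g ?g b)" if b: "b \<in> parcs (skeleton N)" for b
  proof -
    obtain a where a: "a \<in> ?A" "b = map_prod f f a" using b unfolding arcs[symmetric] by (rule imageE)
    have "rot M a \<in> ?A"
      using a assms(2) unfolding rotation_system_def by (simp add: permutes_in_image)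
    then have "map_prod ?g ?g (map_prod f f (rot M a)) = rot M a" by (rule inv)
    then show ?thesis using a rot inv by simp
  qed
  then show ?thesis using bij_betw_inv_into[OF bij] img unfolding oriented_iso_def by auto
qed

lemma equiv_trihex_equiv: "equiv {M. trihex M} trihex_equiv"
proof (rule equivI)
  show "trihex_equiv \<subseteq> {M. trihex M} \<times> {M. trihex M}"
    by (auto simp: trihex_equiv_def)
  have "\<exists>f. oriented_iso f M M" for M
    by (rule exI[of _ id]) (simp add: oriented_iso_def map_prod.id)
  then show "refl_on {M. trihex M} trihex_equiv"
    by (auto simp: refl_on_def trihex_equiv_def)
  show "sym trihex_equiv"
    unfolding trihex_equiv_def trihex_def plane_graph_def
    by (intro symI) (blast intro: oriented_iso_inv)
  show "trans trihex_equiv"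
    unfolding trihex_equiv_def trihex_def plane_graph_def
    by (intro transI) (blast intro: oriented_iso_comp)
qed

text \<open>
  Every finite graph is isomorphic to one whose vertices are natural numbers, so equivalence
  classes of trihexes over \<^typ>\<open>nat\<close> count all trihexes.
\<close>

definition num_symmetric_trihexes :: "nat \<Rightarrow> nat" where
  "num_symmetric_trihexes V =
     card ({M :: nat embedded_graph.
              trihex M \<and> card (pverts (skeleton M)) = V \<and> three_fold_symmetric M} // trihex_equiv)"

end

theory Submission
  imports Defs "HOL-Library.Product_Plus" "HOL-Library.Countable" "HOL-Number_Theory.Number_Theory"
begin

text \<open>
  The rotation and the reversal of darts make the darts of a trihex a transitive set for the group of
  orientation-preserving symmetries of the hexagonal tiling.  Euler's formula gives exactly four
  triangles, so a symmetry of order 3 maps some triangle to itself.  The translations fixing a dart of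
  that triangle form a lattice \<open>K\<close>, which is invariant under a rotation of order 3 because of the
  symmetry and is contained in \<open>2\<int>[\<omega>]\<close> because no edge is fixed by a half turn.  Conversely every such
  lattice \<open>K\<close> is the lattice of exactly one symmetric trihex, whose vertices are the classes of
  \<open>\<int>[\<omega>] / K\<close>.  Hence symmetric trihexes with \<open>4n\<close> vertices correspond to ideals of index \<open>n\<close> in the
  Eisenstein integers, and these are counted prime by prime.
\<close>

section \<open>Counting ideals of the Eisenstein integers\<close>

text \<open>The tiling and its covering map never appear: all arguments are words in
  \<open>\<sigma>\<close> and \<open>\<alpha>\<close> acting on darts. A triangle is a hexagon
  folded by the half turn about its centre, so its darts are those fixed by \<open>h\<close>.
  Starting from such a dart, translations alone reach every vertex, and reversing a dart acts on
  lattice points as \<open>l \<mapsto> dir i - l\<close>; the whole graph is given by formulas over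
  pairs of integers with \<open>K\<close> as the only unknown. The symmetry moves the chosen dart
  along its triangle, and comparing the two stabilisers gives the invariance of \<open>K\<close>.
  Evenness means that \<open>K\<close> is twice an ideal \<open>I\<close> of index \<open>n\<close>.
  This 2 explains both constants: the quotient by \<open>K\<close> has \<open>4 * n\<close>
  elements, and a congruence \<open>2 * l = 2 * u\<close> modulo \<open>K\<close> has as many
  solutions as \<open>I\<close> has classes modulo \<open>K\<close>, namely four. Four solutions for
  each of three dart directions are the 12 triangle darts that Euler's formula demands.\<close>

definition cube_roots :: "nat \<Rightarrow> nat set" where
  "cube_roots N = {b. b < N \<and> N dvd b\<^sup>2 + b + 1}"

text \<open>
  In the coordinates of \<open>hnf_lattice\<close> below, the pair \<open>(e, b)\<close> stands for the ideal of \<open>\<int>[\<zeta>]\<close> with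
  \<open>\<int>\<close>-basis \<open>e (b + \<zeta>)\<close>, \<open>n / e\<close>, where \<open>\<zeta>\<close> is a primitive sixth root of unity; its index is \<open>n\<close>.
\<close>

definition eisenstein_ideals :: "nat \<Rightarrow> (nat \<times> nat) set" where
  "eisenstein_ideals n = (SIGMA e:{e. e\<^sup>2 dvd n}. cube_roots (n div e\<^sup>2))"

lemma finite_cube_roots [simp]: "finite (cube_roots N)"
  by (rule finite_subset[of _ "{..<N}"]) (auto simp: cube_roots_def)

lemma finite_square_divisors: "n > 0 \<Longrightarrow> finite {e::nat. e\<^sup>2 dvd n}"
  by (rule finite_subset[of _ "{..n}"])
    (auto simp: power2_eq_square intro: dvd_imp_le dvd_mult_left)

lemma card_eisenstein_ideals:
  "n > 0 \<Longrightarrow> card (eisenstein_ideals n) = (\<Sum>e | e\<^sup>2 dvd n. card (cube_roots (n div e\<^sup>2)))"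
  unfolding eisenstein_ideals_def by (subst card_SigmaI) (auto simp: finite_square_divisors)

lemma mod_cube_root_iff:
  fixes b m :: nat
  shows "m dvd (b mod m)\<^sup>2 + b mod m + 1 \<longleftrightarrow> m dvd b\<^sup>2 + b + 1"
  by (rule cong_dvd_iff) (intro cong_add cong_pow cong_refl; simp add: cong_def)+

lemma card_cube_roots_mult:
  assumes "coprime m n" "m > 0" "n > 0"
  shows "card (cube_roots (m * n)) = card (cube_roots m) * card (cube_roots n)"
proof -
  have "bij_betw (\<lambda>b. (b mod m, b mod n)) (cube_roots (m * n)) (cube_roots m \<times> cube_roots n)"
  proof (rule bij_betw_imageI)
    show "inj_on (\<lambda>b. (b mod m, b mod n)) (cube_roots (m * n))"
    proof (rule inj_onI)
      fix x y assume "x \<in> cube_roots (m * n)" "y \<in> cube_roots (m * n)"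
        and eq: "(x mod m, x mod n) = (y mod m, y mod n)"
      then have "x < m * n" "y < m * n" by (auto simp: cube_roots_def)
      moreover have "[x = y] (mod m * n)"
        using eq assms by (intro coprime_cong_mult_nat) (auto simp: cong_def)
      ultimately show "x = y" by (simp add: cong_def)
    qed
    show "(\<lambda>b. (b mod m, b mod n)) ` cube_roots (m * n) = cube_roots m \<times> cube_roots n"
    proof (intro equalityI subsetI)
      fix z assume "z \<in> (\<lambda>b. (b mod m, b mod n)) ` cube_roots (m * n)"
      then obtain b where "z = (b mod m, b mod n)" "m * n dvd b\<^sup>2 + b + 1"
        by (auto simp: cube_roots_def)
      then show "z \<in> cube_roots m \<times> cube_roots n"
        using assms mod_cube_root_iff[of m b] mod_cube_root_iff[of n b]
        by (auto simp: cube_roots_def dest: dvd_mult_left dvd_mult_right)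
    next
      fix z assume "z \<in> cube_roots m \<times> cube_roots n"
      then obtain u v where z: "z = (u, v)" "u < m" "v < n" "m dvd u\<^sup>2 + u + 1" "n dvd v\<^sup>2 + v + 1"
        by (auto simp: cube_roots_def)
      obtain x where x: "x < m * n" "[x = u] (mod m)" "[x = v] (mod n)"
        using binary_chinese_remainder_unique_nat[of m n u v] assms by auto
      then have xm: "x mod m = u" "x mod n = v" using z by (auto simp: cong_def)
      have "m dvd x\<^sup>2 + x + 1" "n dvd x\<^sup>2 + x + 1"
        using z xm mod_cube_root_iff[of m x] mod_cube_root_iff[of n x] by auto
      then have "m * n dvd x\<^sup>2 + x + 1" using assms by (simp add: divides_mult)
      then have "x \<in> cube_roots (m * n)" using x by (simp add: cube_roots_def)
      then show "z \<in> (\<lambda>b. (b mod m, b mod n)) ` cube_roots (m * n)"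
        using xm z by force
    qed
  qed
  then have "card (cube_roots (m * n)) = card (cube_roots m \<times> cube_roots n)"
    by (rule bij_betw_same_card)
  then show ?thesis by (simp add: card_cartesian_product)
qed

text \<open>Coprimality separates a divisor of \<open>m * n\<close> into its parts in
  \<open>m\<close> and in \<open>n\<close>, and keeps the square of each part inside its own factor.
  This matches the summation ranges when the two counts are multiplied.\<close>

lemma bij_betw_square_divisors_mult:
  fixes m n :: nat
  assumes "coprime m n"
  shows "bij_betw (\<lambda>(e, e'). e * e') ({e. e\<^sup>2 dvd m} \<times> {e. e\<^sup>2 dvd n}) {e. e\<^sup>2 dvd m * n}"
proof (rule bij_betw_imageI)
  show "inj_on (\<lambda>(e, e'). e * e') ({e. e\<^sup>2 dvd m} \<times> {e. e\<^sup>2 dvd n})"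
  proof (rule inj_onI, clarsimp)
    fix a a' b b' :: nat
    assume h: "a\<^sup>2 dvd m" "a'\<^sup>2 dvd n" "b\<^sup>2 dvd m" "b'\<^sup>2 dvd n" "a * a' = b * b'"
    have d: "a dvd m" "b dvd m" "a' dvd n" "b' dvd n"
      using h by (auto simp: power2_eq_square dest: dvd_mult_left)
    have "coprime a b'" "coprime b a'" "coprime a' b" "coprime b' a"
      using d assms by (meson coprime_divisors coprime_commute)+
    \<comment> \<open>\<open>a\<close> divides \<open>b * b'\<close> and is coprime to
      \<open>b'\<close>, so it divides \<open>b\<close>; the other three divisibilities are
      symmetric.\<close>
    then show "a = b \<and> a' = b'"
      using h(5) by (metis coprime_dvd_mult_left_iff coprime_dvd_mult_right_iff dvd_antisym dvd_triv_left dvd_triv_right)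
  qed
  show "(\<lambda>(e, e'). e * e') ` ({e. e\<^sup>2 dvd m} \<times> {e. e\<^sup>2 dvd n}) = {e. e\<^sup>2 dvd m * n}"
  proof (intro equalityI subsetI)
    fix e assume "e \<in> {e. e\<^sup>2 dvd m * n}"
    then have e: "e\<^sup>2 dvd m * n" by simp
    then have "e dvd m * n" by (auto simp: power2_eq_square dest: dvd_mult_left)
    then obtain a b where ab: "e = a * b" "a dvd m" "b dvd n" by (meson division_decomp)
    have "a\<^sup>2 dvd m * n" "b\<^sup>2 dvd m * n"
      using e ab by (auto simp: power_mult_distrib dest: dvd_mult_left dvd_mult_right)
    moreover have "coprime (a\<^sup>2) n" "coprime (b\<^sup>2) m"
      using coprime_divisors[OF ab(2) dvd_refl assms] coprime_divisors[OF dvd_refl ab(3) assms]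
      by (simp_all add: coprime_commute)
    ultimately have "a\<^sup>2 dvd m" "b\<^sup>2 dvd n"
      by (simp_all add: coprime_dvd_mult_left_iff coprime_dvd_mult_right_iff)
    then show "e \<in> (\<lambda>(e, e'). e * e') ` ({e. e\<^sup>2 dvd m} \<times> {e. e\<^sup>2 dvd n})"
      using ab by force
  qed (auto simp: power_mult_distrib intro: mult_dvd_mono)
qed

lemma card_eisenstein_ideals_mult:
  assumes "coprime m n" "m > 0" "n > 0"
  shows "card (eisenstein_ideals (m * n)) = card (eisenstein_ideals m) * card (eisenstein_ideals n)"
proof -
  let ?f = "\<lambda>n e. card (cube_roots (n div e\<^sup>2))"
  have split: "?f (m * n) (a * b) = ?f m a * ?f n b" if ab: "a\<^sup>2 dvd m" "b\<^sup>2 dvd n" for a b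
  proof -
    have "m * n div (a * b)\<^sup>2 = (m div a\<^sup>2) * (n div b\<^sup>2)"
      using ab by (simp add: power_mult_distrib div_mult_div_if_dvd)
    moreover have "coprime (m div a\<^sup>2) (n div b\<^sup>2)"
      using assms(1) ab by (metis coprime_divisors dvd_div_mult_self dvd_triv_left)
    moreover have "m div a\<^sup>2 > 0" "n div b\<^sup>2 > 0"
      using ab assms by (auto simp: dvd_div_eq_0_iff)
    ultimately show ?thesis by (simp add: card_cube_roots_mult)
  qed
  have "card (eisenstein_ideals (m * n)) = (\<Sum>e | e\<^sup>2 dvd m * n. ?f (m * n) e)"
    using assms by (simp add: card_eisenstein_ideals)
  also have "\<dots> = (\<Sum>(a, b) \<in> {e. e\<^sup>2 dvd m} \<times> {e. e\<^sup>2 dvd n}. ?f (m * n) (a * b))"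
    using sum.reindex_bij_betw[OF bij_betw_square_divisors_mult[OF assms(1)], of "?f (m * n)"]
    by (simp add: case_prod_beta')
  also have "\<dots> = (\<Sum>(a, b) \<in> {e. e\<^sup>2 dvd m} \<times> {e. e\<^sup>2 dvd n}. ?f m a * ?f n b)"
    by (intro sum.cong) (auto simp: split)
  also have "\<dots> = (\<Sum>e | e\<^sup>2 dvd m. ?f m e) * (\<Sum>e | e\<^sup>2 dvd n. ?f n e)"
    by (simp add: sum_product sum.cartesian_product)
  finally show ?thesis using assms by (simp add: card_eisenstein_ideals)
qed

lemma eisenstein_ideals_1: "card (eisenstein_ideals 1) = 1"
proof -
  have "eisenstein_ideals 1 = {(1, 0)}"
    by (auto simp: eisenstein_ideals_def cube_roots_def)
  then show ?thesis by simp
qed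

lemma card_eisenstein_ideals_prod:
  assumes "finite S" "\<And>i. i \<in> S \<Longrightarrow> g i > 0"
    "\<And>i j. i \<in> S \<Longrightarrow> j \<in> S \<Longrightarrow> i \<noteq> j \<Longrightarrow> coprime (g i) (g j)"
  shows "card (eisenstein_ideals (\<Prod>i\<in>S. g i)) = (\<Prod>i\<in>S. card (eisenstein_ideals (g i)))"
  using assms
proof (induction S rule: finite_induct)
  case empty
  then show ?case using eisenstein_ideals_1 by simp
next
  case (insert x F)
  have "coprime (g x) (\<Prod>i\<in>F. g i)"
    using insert by (intro prod_coprime_right) auto
  moreover have "(\<Prod>i\<in>F. g i) > 0" using insert by (intro prod_pos) auto
  ultimately show ?case
    using insert card_eisenstein_ideals_mult[of "g x" "\<Prod>i\<in>F. g i"] by simp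
qed

text \<open>An ideal is an integer \<open>e\<close> times a primitive ideal. Here
  \<open>e = p ^ j\<close>, and the primitive part is counted by residues.\<close>

lemma card_eisenstein_ideals_prime_power:
  assumes "prime p"
  shows "card (eisenstein_ideals (p ^ k)) = (\<Sum>j\<le>k div 2. card (cube_roots (p ^ (k - 2 * j))))"
proof -
  have p: "p > 1" using assms by (rule prime_gt_1_nat)
  have "{e. e\<^sup>2 dvd p ^ k} = (\<lambda>j. p ^ j) ` {..k div 2}"
  proof (intro equalityI subsetI)
    fix e assume "e \<in> {e. e\<^sup>2 dvd p ^ k}"
    then have e: "e\<^sup>2 dvd p ^ k" by simp
    then have "e dvd p ^ k" by (auto simp: power2_eq_square dest: dvd_mult_left)
    then obtain j where j: "e = p ^ j" using assms divides_primepow_nat by blast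
    then have "p ^ (j * 2) dvd p ^ k" using e by (simp add: power_mult)
    then have "j * 2 \<le> k" using p power_dvd_imp_le by blast
    then show "e \<in> (\<lambda>j. p ^ j) ` {..k div 2}" using j by auto
  qed (auto simp: power_mult[symmetric] intro!: le_imp_power_dvd)
  moreover have "inj_on (\<lambda>j. p ^ j) {..k div 2}"
    using p by (auto intro!: inj_onI)
  moreover have "p ^ k div (p ^ j)\<^sup>2 = p ^ (k - 2 * j)" if "j \<le> k div 2" for j
    using that p by (simp add: power_mult[symmetric] power_diff mult.commute)
  ultimately show ?thesis
    using p by (simp add: card_eisenstein_ideals sum.reindex)
qed

section \<open>Roots of \<open>b\<^sup>2 + b + 1\<close> modulo prime powers\<close>

lemma cube_roots_1: "card (cube_roots 1) = 1"
proof -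
  have "cube_roots 1 = {0}" by (auto simp: cube_roots_def)
  then show ?thesis by simp
qed

lemma cong_cube_root_pow3:
  fixes b N :: nat
  assumes "N dvd b\<^sup>2 + b + 1"
  shows "[b ^ 3 = 1] (mod N)"
proof -
  have "int N dvd int (b\<^sup>2 + b + 1)" using assms by (simp only: of_nat_dvd_iff)
  then have "int N dvd (int b - 1) * int (b\<^sup>2 + b + 1)" by (rule dvd_mult)
  also have "(int b - 1) * int (b\<^sup>2 + b + 1) = int (b ^ 3) - int 1"
    by (simp add: power2_eq_square power3_eq_cube algebra_simps)
  finally show ?thesis by (simp add: cong_iff_dvd_diff flip: cong_int_iff)
qed

text \<open>A root is a cube root of 1. As 3 does not divide \<open>q - 1\<close>, Fermat's theorem
  leaves only the root 1, which would make \<open>q\<close> divide 3.\<close>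

lemma cube_roots_inert:
  assumes "prime q" "q mod 3 = 2" "j > 0"
  shows "cube_roots (q ^ j) = {}"
proof (rule ccontr)
  assume "cube_roots (q ^ j) \<noteq> {}"
  then obtain b where "q ^ j dvd b\<^sup>2 + b + 1" by (auto simp: cube_roots_def)
  then have b: "q dvd b\<^sup>2 + b + 1" using assms(3) by (metis dvd_power dvd_trans)
  have b3: "[b ^ 3 = 1] (mod q)" using b by (rule cong_cube_root_pow3)
  have "\<not> q dvd b"
  proof
    assume "q dvd b"
    then have "q dvd b\<^sup>2 + b" by (auto simp: power2_eq_square)
    then have "q dvd 1" using b dvd_add_right_iff by blast
    then show False using assms(1) by simp
  qed
  then have "[b ^ (q - 1) = 1] (mod q)" using assms(1) fermat_theorem by blast
  moreover obtain c where c: "q - 1 = 3 * c + 1"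
  proof
    show "q - 1 = 3 * ((q - 2) div 3) + 1" using assms(2) by presburger
  qed
  ultimately have "[(b ^ 3) ^ c * b = 1] (mod q)" by (simp add: power_add power_mult mult.commute[of b])
  moreover have "[(b ^ 3) ^ c * b = 1 ^ c * b] (mod q)"
    by (intro cong_mult cong_pow b3 cong_refl)
  ultimately have b1: "[b = 1] (mod q)" by (metis cong_trans cong_sym mult_1 power_one)
  have "[b\<^sup>2 + b + 1 = 1\<^sup>2 + 1 + 1] (mod q)" by (intro cong_add cong_pow b1 cong_refl)
  then have "q dvd 3" using b by (simp add: cong_dvd_iff numeral_3_eq_3)
  then have "q = 3" using assms(1) by (simp add: primes_dvd_imp_eq)
  then show False using assms(2) by simp
qed

lemma cube_roots_3: "cube_roots 3 = {1}"
proof -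
  have "b < 3 \<and> 3 dvd b\<^sup>2 + b + 1 \<longleftrightarrow> b = 1" for b :: nat
  proof -
    consider "b = 0" | "b = 1" | "b = 2" | "b \<ge> 3" by linarith
    then show ?thesis by cases (simp_all add: One_nat_def[symmetric] del: One_nat_def)
  qed
  then show ?thesis by (auto simp: cube_roots_def)
qed

text \<open>Nothing survives modulo 9, as the nine residues show, and higher powers of 3 reduce to
  this case. Together with the single root modulo 3 this is the behaviour of a ramified
  prime.\<close>

lemma cube_roots_3_power:
  assumes "j \<ge> 2"
  shows "cube_roots (3 ^ j) = {}"
proof -
  have "\<not> 3 ^ j dvd b\<^sup>2 + b + 1" for b :: nat
  proof
    assume "3 ^ j dvd b\<^sup>2 + b + 1"
    moreover have "(3::nat) ^ 2 dvd 3 ^ j" using assms by (rule le_imp_power_dvd)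
    ultimately have "3 ^ 2 dvd b\<^sup>2 + b + 1" by (meson dvd_trans)
    then have "9 dvd b\<^sup>2 + b + 1" by simp
    then have d: "9 dvd (b mod 9)\<^sup>2 + b mod 9 + 1" using mod_cube_root_iff[of 9 b] by simp
    have "b mod 9 < 9" by simp
    then have "b mod 9 \<in> {0,1,2,3,4,5,6,7,8}" by auto
    then show False using d by (elim insertE) (simp_all add: One_nat_def[symmetric] del: One_nat_def)
  qed
  then show ?thesis by (auto simp: cube_roots_def)
qed

text \<open>A primitive root \<open>g\<close> exists modulo every power of an odd prime, so no
  lifting of roots is needed. Since 3 divides \<open>p - 1\<close>, a power of \<open>g\<close> has
  order exactly 3, and \<open>p\<close> can divide only one of the two factors of
  \<open>x ^ 3 - 1\<close>.\<close>

lemma cube_roots_split_exists: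
  fixes p j :: nat
  assumes "prime p" "p mod 3 = 1" "j > 0"
  shows "\<exists>x. p ^ j dvd x\<^sup>2 + x + 1"
proof -
  have odd: "odd p" using assms(1,2) prime_odd_nat[of p] prime_ge_2_nat[of p] by (cases "p = 2") auto
  obtain g where g: "residue_primroot (p ^ j) g"
    using residue_primroot_odd_prime_power_exists[OF assms(1) odd] assms(3) by blast
  have tot: "totient (p ^ j) = p ^ (j - 1) * (p - 1)"
    using assms by (simp add: totient_prime_power)
  have "3 dvd p - 1" using assms(2) by presburger
  then obtain c where c: "totient (p ^ j) = 3 * c" using tot by auto
  have pj: "p ^ j > 1" using assms prime_gt_1_nat one_less_power by blast
  have "totient (p ^ j) > 0" using pj by (simp only: totient_gt_0_iff)
  then have cpos: "c > 0" using c by simp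
  have ordc: "ord (p ^ j) g = 3 * c"
    using g c by (auto simp: residue_primroot_def)
  define x where "x = g ^ c"
  have x3: "[x ^ 3 = 1] (mod p ^ j)"
    unfolding x_def using ordc ord_divides[of g "3 * c" "p ^ j"] by (simp add: mult.commute flip: power_mult)
  have x1: "\<not> [x = 1] (mod p ^ j)"
  proof
    assume "[x = 1] (mod p ^ j)"
    then have "3 * c dvd c" using ord_divides[of g c "p ^ j"] unfolding x_def ordc by blast
    then show False using cpos by (auto dest: dvd_imp_le)
  qed
  let ?y = "int x"
  have "int (p ^ j) dvd ?y ^ 3 - 1"
    using x3 by (simp add: cong_iff_dvd_diff flip: cong_int_iff)
  then have prod: "int (p ^ j) dvd (?y - 1) * (?y\<^sup>2 + ?y + 1)"
    by (simp add: power2_eq_square power3_eq_cube algebra_simps)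
  have "\<not> int p dvd ?y - 1"
  proof
    assume a: "int p dvd ?y - 1"
    have "\<not> int p dvd ?y\<^sup>2 + ?y + 1"
    proof
      assume "int p dvd ?y\<^sup>2 + ?y + 1"
      \<comment> \<open>Polynomial division:
        \<open>y\<^sup>2 + y + 1 = (y - 1) * (y + 2) + 3\<close>, so a prime dividing both factors
        divides 3.\<close>
      moreover have "int p dvd (?y - 1) * (?y + 2)" using a by simp
      ultimately have "int p dvd (?y\<^sup>2 + ?y + 1) - (?y - 1) * (?y + 2)" by (rule dvd_diff)
      then have "int p dvd 3" by (simp add: power2_eq_square algebra_simps)
      then have "int p dvd int 3" by simp
      then have "p dvd 3" by (simp only: of_nat_dvd_iff)
      then have "p = 3" using assms(1) by (simp add: primes_dvd_imp_eq)
      then show False using assms(2) by simp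
    qed
    then have "coprime (int (p ^ j)) (?y\<^sup>2 + ?y + 1)"
      using assms(1) by (simp add: prime_imp_coprime)
    then have "int (p ^ j) dvd ?y - 1" using prod by (simp add: coprime_dvd_mult_left_iff)
    then show False using x1 by (simp add: cong_iff_dvd_diff flip: cong_int_iff)
  qed
  then have "coprime (int (p ^ j)) (?y - 1)"
    using assms(1) by (simp add: prime_imp_coprime)
  then have "int (p ^ j) dvd ?y\<^sup>2 + ?y + 1" using prod by (simp add: coprime_dvd_mult_right_iff)
  also have "?y\<^sup>2 + ?y + 1 = int (x\<^sup>2 + x + 1)" by simp
  finally show ?thesis by (meson of_nat_dvd_iff)
qed

text \<open>For two roots \<open>b\<close> and \<open>c\<close> the product
  \<open>(c - b) * (c + b + 1)\<close> is divisible by \<open>p ^ j\<close>. The prime cannot divide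
  both factors, since it would then divide \<open>2 * b + 1\<close>, whose square is -3 modulo
  \<open>p\<close>; so one factor takes the whole power.\<close>

lemma card_cube_roots_split:
  assumes "prime p" "p mod 3 = 1" "j > 0"
  shows "card (cube_roots (p ^ j)) = 2"
proof -
  let ?n = "p ^ j"
  obtain x where "?n dvd x\<^sup>2 + x + 1" using cube_roots_split_exists[OF assms] by blast
  then have bb: "?n dvd (x mod ?n)\<^sup>2 + x mod ?n + 1" by (simp only: mod_cube_root_iff)
  define b where "b = x mod ?n"
  have npos: "?n > 0" using assms by (simp add: prime_gt_0_nat)
  have b: "b < ?n" "?n dvd b\<^sup>2 + b + 1" using bb npos unfolding b_def by simp_all
  \<comment> \<open>The two roots have sum -1; this is \<open>-1 - b\<close> brought into the range
    below \<open>?n\<close>.\<close>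
  define b' where "b' = ?n - 1 - b"
  have ib': "int b' = int ?n - 1 - int b" using b unfolding b'_def by (simp add: of_nat_diff)
  have bi: "int ?n dvd (int b)\<^sup>2 + int b + 1"
    using b(2) of_nat_dvd_iff[of ?n "b\<^sup>2 + b + 1", where 'a=int] by (simp add: algebra_simps)
  have b'i: "int ?n dvd (int b')\<^sup>2 + int b' + 1"
  proof -
    have "(int b')\<^sup>2 + int b' + 1 = int ?n * (int ?n - 1 - 2 * int b) + ((int b)\<^sup>2 + int b + 1)"
      unfolding ib' by (simp add: power2_eq_square algebra_simps)
    then show ?thesis using bi by (metis dvd_add dvd_triv_left)
  qed
  have b': "b' < ?n" "?n dvd b'\<^sup>2 + b' + 1"
    using npos b'i of_nat_dvd_iff[of ?n "b'\<^sup>2 + b' + 1", where 'a=int] by (auto simp: b'_def algebra_simps)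
  have pn: "int p dvd int ?n" using assms(3) by simp
  have np: "\<not> int p dvd 2 * int b + 1"
  proof
    assume "int p dvd 2 * int b + 1"
    then have "int p dvd (2 * int b + 1) * (2 * int b + 1)" by simp
    moreover have "int p dvd 4 * ((int b)\<^sup>2 + int b + 1)" using bi pn dvd_trans dvd_mult by blast
    ultimately have "int p dvd 4 * ((int b)\<^sup>2 + int b + 1) - (2 * int b + 1) * (2 * int b + 1)"
      by (metis dvd_diff)
    then have "int p dvd 3" by (simp add: power2_eq_square algebra_simps)
    then have "int p dvd int 3" by simp
    then have "p dvd 3" by (simp only: of_nat_dvd_iff)
    then have "p = 3" using assms(1) by (simp add: primes_dvd_imp_eq)
    then show False using assms(2) by simp
  qed
  have ne: "b \<noteq> b'"
  proof
    assume "b = b'"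
    then have "2 * int b + 1 = int ?n" using ib' by simp
    then show False using np pn by simp
  qed
  have "c = b \<or> c = b'" if c: "c < ?n" "?n dvd c\<^sup>2 + c + 1" for c
  proof -
    have ci: "int ?n dvd (int c)\<^sup>2 + int c + 1"
      using c(2) of_nat_dvd_iff[of ?n "c\<^sup>2 + c + 1", where 'a=int] by (simp add: algebra_simps)
    have "int ?n dvd ((int c)\<^sup>2 + int c + 1) - ((int b)\<^sup>2 + int b + 1)" using ci bi by (rule dvd_diff)
    then have pr: "int ?n dvd (int c - int b) * (int c + int b + 1)"
      by (simp add: power2_eq_square algebra_simps)
    show ?thesis
    proof (cases "int p dvd int c - int b")
      case True
      have "\<not> int p dvd int c + int b + 1"
      proof
        assume "int p dvd int c + int b + 1"
        then have "int p dvd (int c + int b + 1) - (int c - int b)" using True by (rule dvd_diff)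
        then show False using np by (simp add: algebra_simps)
      qed
      then have "coprime (int ?n) (int c + int b + 1)"
        using assms(1) by (simp add: prime_imp_coprime)
      then have "int ?n dvd int c - int b" using pr by (simp add: coprime_dvd_mult_left_iff)
      then have "[c = b] (mod ?n)" by (simp add: cong_iff_dvd_diff flip: cong_int_iff)
      then show ?thesis using c b by (simp add: cong_def)
    next
      case False
      then have "coprime (int ?n) (int c - int b)"
        using assms(1) by (simp add: prime_imp_coprime)
      then have "int ?n dvd int c + int b + 1" using pr by (simp add: coprime_dvd_mult_right_iff)
      moreover have "int c - int b' = (int c + int b + 1) - int ?n" using ib' by simp
      ultimately have "int ?n dvd int c - int b'" by (metis dvd_diff dvd_refl)
      then have "[c = b'] (mod ?n)" by (simp add: cong_iff_dvd_diff flip: cong_int_iff)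
      then show ?thesis using c b' by (simp add: cong_def)
    qed
  qed
  then have "cube_roots ?n = {b, b'}" using b b' by (auto simp: cube_roots_def)
  then show ?thesis using ne by simp
qed

lemma card_eisenstein_ideals_split:
  assumes "prime p" "p mod 3 = 1"
  shows "card (eisenstein_ideals (p ^ k)) = k + 1"
proof -
  have "card (eisenstein_ideals (p ^ k)) = (\<Sum>j\<le>k div 2. if 2 * j = k then 1 else 2)"
    unfolding card_eisenstein_ideals_prime_power[OF assms(1)]
    by (intro sum.cong refl) (use cube_roots_1 card_cube_roots_split[OF assms] in auto)
  also have "\<dots> = k + 1"
  proof -
    \<comment> \<open>Only the last index \<open>k div 2\<close> can contribute 1, namely for even
      \<open>k\<close>; all others contribute 2.\<close>
    have "(\<Sum>j<k div 2. if 2 * j = k then 1 else 2) = (\<Sum>j<k div 2. 2::nat)"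
      by (intro sum.cong) auto
    then show ?thesis by (auto simp: lessThan_Suc_atMost[symmetric])
  qed
  finally show ?thesis .
qed

lemma card_eisenstein_ideals_ramified: "card (eisenstein_ideals (3 ^ k)) = 1"
proof -
  have prime3: "prime (3::nat)" by simp
  have "card (eisenstein_ideals (3 ^ k)) = (\<Sum>j\<le>k div 2. if j = k div 2 then 1 else 0)"
    unfolding card_eisenstein_ideals_prime_power[OF prime3]
  proof (intro sum.cong refl)
    fix j assume "j \<in> {..k div 2}"
    then have "k - 2 * j = 0 \<or> k - 2 * j = 1" if "j = k div 2" using that by presburger
    moreover have "k - 2 * j \<ge> 2" if "j \<noteq> k div 2"
      using that \<open>j \<in> {..k div 2}\<close> by simp
    ultimately show "card (cube_roots (3 ^ (k - 2 * j))) = (if j = k div 2 then 1 else 0)"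
      using cube_roots_1 cube_roots_3 cube_roots_3_power by (cases "j = k div 2") auto
  qed
  then show ?thesis by simp
qed

lemma card_eisenstein_ideals_inert:
  assumes "prime q" "q mod 3 = 2"
  shows "card (eisenstein_ideals (q ^ k)) = (if even k then 1 else 0)"
proof -
  have "card (eisenstein_ideals (q ^ k)) = (\<Sum>j\<le>k div 2. if 2 * j = k then 1 else 0)"
    unfolding card_eisenstein_ideals_prime_power[OF assms(1)]
    by (intro sum.cong refl) (use cube_roots_1 cube_roots_inert[OF assms] in auto)
  also have "\<dots> = (if even k then 1 else 0)"
  proof (cases "even k")
    case True
    then have "(2 * j = k) = (j = k div 2)" for j by auto
    then show ?thesis using True by simp
  next
    case False
    then have "2 * j \<noteq> k" for j by auto
    then show ?thesis using False by simp
  qed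
  finally show ?thesis .
qed

lemma card_eisenstein_ideals_factorization:
  fixes m r s n :: nat and p k q l :: "nat \<Rightarrow> nat"
  assumes n: "n = 3 ^ m * (\<Prod>i=1..r. p i ^ k i) * (\<Prod>j=1..s. q j ^ l j)"
    and injp: "inj_on p {1..r}"
    and p: "\<And>i. i \<in> {1..r} \<Longrightarrow> prime (p i) \<and> p i mod 3 = 1"
    and injq: "inj_on q {1..s}"
    and q: "\<And>j. j \<in> {1..s} \<Longrightarrow> prime (q j) \<and> q j mod 3 = 2"
  shows "card (eisenstein_ideals n) =
    (\<Prod>i=1..r. k i + 1) * (\<Prod>j=1..s. if even (l j) then 1 else 0)"
proof -
  let ?A = "\<Prod>i=1..r. p i ^ k i" and ?B = "\<Prod>j=1..s. q j ^ l j"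
  have cop: "coprime (a ^ i) (b ^ j)" if "prime a" "prime b" "a \<noteq> b" for a b i j :: nat
    using that by (simp add: primes_coprime)
  have p3: "prime (3::nat)" by simp
  have pos: "?A > 0" "?B > 0" using p q by (auto intro!: prod_pos simp: prime_gt_0_nat)
  have A: "card (eisenstein_ideals ?A) = (\<Prod>i=1..r. k i + 1)"
  proof -
    have "card (eisenstein_ideals ?A) = (\<Prod>i=1..r. card (eisenstein_ideals (p i ^ k i)))"
      by (intro card_eisenstein_ideals_prod cop) (use p injp in \<open>auto simp: prime_gt_0_nat dest: inj_onD\<close>)
    then show ?thesis using p by (simp add: card_eisenstein_ideals_split)
  qed
  have B: "card (eisenstein_ideals ?B) = (\<Prod>j=1..s. if even (l j) then 1 else 0)"
  proof -
    have "card (eisenstein_ideals ?B) = (\<Prod>j=1..s. card (eisenstein_ideals (q j ^ l j)))"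
      by (intro card_eisenstein_ideals_prod cop) (use q injq in \<open>auto simp: prime_gt_0_nat dest: inj_onD\<close>)
    then show ?thesis using q by (simp add: card_eisenstein_ideals_inert)
  qed
  have ne: "3 \<noteq> p i" if "i \<in> {1..r}" for i using p[OF that] by auto
  have ne': "3 \<noteq> q j" if "j \<in> {1..s}" for j using q[OF that] by auto
  have ne'': "p i \<noteq> q j" if "i \<in> {1..r}" "j \<in> {1..s}" for i j using p[OF that(1)] q[OF that(2)] by auto
  have "coprime (3 ^ m) ?A"
    by (rule prod_coprime_right) (metis cop p3 p ne)
  moreover have "coprime (3 ^ m) ?B"
    by (rule prod_coprime_right) (metis cop p3 q ne')
  moreover have "coprime ?A ?B"
    by (rule prod_coprime_right, rule prod_coprime_left) (metis cop p q ne'')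
  ultimately have "card (eisenstein_ideals n) =
      card (eisenstein_ideals (3 ^ m)) * card (eisenstein_ideals ?A) * card (eisenstein_ideals ?B)"
    using pos unfolding n by (simp add: card_eisenstein_ideals_mult)
  then show ?thesis unfolding A B card_eisenstein_ideals_ramified by simp
qed

section \<open>Orbits\<close>

lemma funpow_eq_self_iff:
  assumes "x \<in> orbit f x"
  shows "(f ^^ k) x = x \<longleftrightarrow> card (orbit f x) dvd k"
proof -
  let ?n = "funpow_dist1 f x x"
  have card: "card (orbit f x) = ?n"
    using inj_on_funpow_dist1[OF assms] orbit_conv_funpow_dist1[OF assms] by (simp add: card_image)
  have n: "(f ^^ ?n) x = x" using assms by (rule funpow_dist1_prop)
  then have "(f ^^ k) x = (f ^^ (k mod ?n)) x" by (rule funpow_mod_eq[symmetric])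
  moreover have "(f ^^ (k mod ?n)) x = x \<longleftrightarrow> k mod ?n = 0"
    using funpow_dist1_least[of "k mod ?n" f x x] by (cases "k mod ?n = 0") (auto simp del: funpow.simps)
  ultimately show ?thesis unfolding card by (simp add: dvd_eq_mod_eq_0)
qed

lemma self_in_orbitI: "(f ^^ n) x = x \<Longrightarrow> n > 0 \<Longrightarrow> x \<in> orbit f x"
  by (auto simp: orbit_altdef) metis

text \<open>Double counting with a weight that depends only on the orbit. Weight 1 counts darts by
  faces; \<open>six_card_orbits\<close> chooses it so that all faces get the same total.\<close>

lemma sum_over_orbits:
  fixes w :: "'a set \<Rightarrow> nat"
  assumes fin: "finite D" and self: "\<And>x. x \<in> D \<Longrightarrow> x \<in> orbit f x" and closed: "\<And>x. x \<in> D \<Longrightarrow> f x \<in> D"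
  shows "(\<Sum>x\<in>D. w (orbit f x)) = (\<Sum>B\<in>orbit f ` D. card B * w B)"
proof -
  have sub: "y \<in> D" if "y \<in> orbit f x" "x \<in> D" for x y
    using that by induct (auto intro: closed)
  have eq: "orbit f y = orbit f x" if "y \<in> orbit f x" "x \<in> D" for x y
    using that self[OF sub[OF that]] self[OF that(2)] by (meson orbit_swap orbit_trans subsetI subset_antisym)
  have fib: "{x \<in> D. orbit f x = B} = B" if "B \<in> orbit f ` D" for B
    using that eq sub self by blast
  have "(\<Sum>x\<in>D. w (orbit f x)) = (\<Sum>B\<in>orbit f ` D. \<Sum>x | x \<in> D \<and> orbit f x = B. w (orbit f x))"
    by (rule sum.image_gen[OF fin])
  also have "\<dots> = (\<Sum>B\<in>orbit f ` D. card B * w B)"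
  proof (intro sum.cong refl)
    fix B assume "B \<in> orbit f ` D"
    moreover have "(\<Sum>x | x \<in> D \<and> orbit f x = B. w (orbit f x)) = (\<Sum>x | x \<in> D \<and> orbit f x = B. w B)"
      by (intro sum.cong) auto
    ultimately show "(\<Sum>x | x \<in> D \<and> orbit f x = B. w (orbit f x)) = card B * w B"
      using fib[of B] by simp
  qed
  finally show ?thesis .
qed

text \<open>Every orbit has a size that divides \<open>p\<close> and is not 1. Applied with
  \<open>p = 2\<close> to dart reversal and, in contraposition, with \<open>p = 3\<close> to the
  four triangles.\<close>

lemma prime_dvd_card_if_no_fixpoint:
  assumes "finite S" "prime p" and closed: "\<And>x. x \<in> S \<Longrightarrow> g x \<in> S"
    and per: "\<And>x. x \<in> S \<Longrightarrow> (g ^^ p) x = x" and free: "\<And>x. x \<in> S \<Longrightarrow> g x \<noteq> x"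
  shows "p dvd card S"
proof -
  have self: "x \<in> orbit g x" if "x \<in> S" for x
    using self_in_orbitI[OF per[OF that]] assms(2) by (simp add: prime_gt_0_nat)
  have "card (orbit g x) = p" if "x \<in> S" for x
  proof -
    have "card (orbit g x) dvd p" using per[OF that] funpow_eq_self_iff[OF self[OF that]] by blast
    moreover have "card (orbit g x) \<noteq> 1"
      using free[OF that] funpow_eq_self_iff[OF self[OF that], of 1] by auto
    ultimately show ?thesis using assms(2) by (auto simp: prime_nat_iff)
  qed
  then have "(\<Sum>B\<in>orbit g ` S. card B * 1) = (\<Sum>B\<in>orbit g ` S. p)" by (intro sum.cong) auto
  then have "card S = card (orbit g ` S) * p"
    using sum_over_orbits[OF assms(1) self closed, of "\<lambda>_. 1"] by simp
  then show ?thesis by simp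
qed

lemma six_card_orbits:
  assumes "finite D" and self: "\<And>x. x \<in> D \<Longrightarrow> x \<in> orbit f x" and closed: "\<And>x. x \<in> D \<Longrightarrow> f x \<in> D"
    and card: "\<And>x. x \<in> D \<Longrightarrow> card (orbit f x) = 3 \<or> card (orbit f x) = 6"
  shows "6 * card (orbit f ` D) = card D + card {x \<in> D. (f ^^ 3) x = x}"
proof -
  \<comment> \<open>Weight 2 on triangles and 1 on hexagons gives every face the total 6; a dart
    then weighs one more exactly if three face steps bring it back.\<close>
  let ?w = "\<lambda>B :: 'a set. if card B = 3 then 2 else 1 :: nat"
  have "6 * card (orbit f ` D) = (\<Sum>B\<in>orbit f ` D. card B * ?w B)"
  proof -
    have "(\<Sum>B\<in>orbit f ` D. card B * ?w B) = (\<Sum>B\<in>orbit f ` D. 6)"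
      by (intro sum.cong refl) (use card in fastforce)
    then show ?thesis by simp
  qed
  also have "\<dots> = (\<Sum>x\<in>D. ?w (orbit f x))"
    using sum_over_orbits[OF assms(1) self closed, of ?w] by simp
  also have "\<dots> = (\<Sum>x\<in>D. 1 + (if (f ^^ 3) x = x then 1 else 0))"
  proof (intro sum.cong refl)
    fix x assume "x \<in> D"
    then show "?w (orbit f x) = 1 + (if (f ^^ 3) x = x then 1 else 0)"
      using card[of x] funpow_eq_self_iff[OF self[of x], of 3] by auto
  qed
  also have "\<dots> = card D + card {x \<in> D. (f ^^ 3) x = x}"
    unfolding sum.distrib using assms(1) by (simp add: sum.If_cases Int_def)
  finally show ?thesis .
qed

section \<open>Lattices invariant under a rotation of order 3\<close>

text \<open>With \<open>(x, y)\<close> read as \<open>x + y * \<zeta>\<close>, the map in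
  \<open>rho_mem\<close> is multiplication by \<open>\<zeta>\<^sup>2 = \<zeta> - 1\<close>, a
  primitive cube root of unity. So these are the ideals of \<open>\<int>[\<zeta>]\<close>, the zero
  ideal included.\<close>

locale rotation_lattice =
  fixes K :: "(int \<times> int) set"
  assumes zero_mem: "(0, 0) \<in> K"
    and diff_mem: "l \<in> K \<Longrightarrow> m \<in> K \<Longrightarrow> l - m \<in> K"
    and rho_mem: "(x, y) \<in> K \<Longrightarrow> (- x - y, x) \<in> K"
begin

lemma uminus_mem: "l \<in> K \<Longrightarrow> - l \<in> K"
  using diff_mem[OF zero_mem, of l] by (simp flip: zero_prod_def)

lemma uminus_mem_iff: "- l \<in> K \<longleftrightarrow> l \<in> K"
  using uminus_mem[of l] uminus_mem[of "- l"] by auto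

lemma add_mem: "l \<in> K \<Longrightarrow> m \<in> K \<Longrightarrow> l + m \<in> K"
  using diff_mem[of l "- m"] uminus_mem by simp

lemma scale_mem:
  assumes "(x, y) \<in> K"
  shows "(k * x, k * y) \<in> K"
proof (induction k rule: int_induct[of _ 0])
  case base
  then show ?case using zero_mem by simp
next
  case (step1 i)
  then show ?case using add_mem[OF step1(2) assms] by (simp add: algebra_simps)
next
  case (step2 i)
  then show ?case using diff_mem[OF step2(2) assms] by (simp add: algebra_simps)
qed

lemma rho_mem_iff: "(- x - y, x) \<in> K \<longleftrightarrow> (x, y) \<in> K"
proof
  assume "(- x - y, x) \<in> K"
  then have "(- (- x - y) - x, - x - y) \<in> K" by (rule rho_mem)
  then have "(y, - x - y) \<in> K" by simp
  then have "(- y - (- x - y), y) \<in> K" by (rule rho_mem)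
  then show "(x, y) \<in> K" by simp
qed (rule rho_mem)

end

text \<open>Hermite normal form: the lattice with basis \<open>(e * b, e)\<close>,
  \<open>(e * n, 0)\<close>, of index \<open>e\<^sup>2 * n\<close> for positive \<open>e\<close> and
  \<open>n\<close>. The factor \<open>e\<close> common to both coordinates is no loss for lattices
  invariant under the rotation.\<close>

definition hnf_lattice :: "nat \<Rightarrow> nat \<Rightarrow> nat \<Rightarrow> (int \<times> int) set" where
  "hnf_lattice e n b = {(x, y). int e dvd y \<and> int e * int n dvd x - int b * y}"

lemma mem_hnf_lattice:
  "(x, y) \<in> hnf_lattice e n b \<longleftrightarrow> int e dvd y \<and> int e * int n dvd x - int b * y"
  by (simp add: hnf_lattice_def)

lemma hnf_lattice_dvd_fst:
  assumes "(x, y) \<in> hnf_lattice e n b"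
  shows "int e dvd x"
proof -
  have "int e dvd x - int b * y" "int e dvd int b * y"
    using assms by (auto simp: mem_hnf_lattice dest: dvd_mult_left)
  then show ?thesis using dvd_diffD1 by (metis add.commute dvd_add_right_iff diff_add_cancel)
qed

text \<open>With \<open>x\<close> congruent to \<open>b * y\<close>, the condition on the rotated
  vector becomes divisibility of \<open>y * (b\<^sup>2 + b + 1)\<close>; \<open>e\<close> divides
  the first factor and \<open>n\<close> the second.\<close>

lemma rotation_lattice_hnf:
  assumes "n dvd b\<^sup>2 + b + 1"
  shows "rotation_lattice (hnf_lattice e n b)"
proof
  show "(0, 0) \<in> hnf_lattice e n b" by (simp add: mem_hnf_lattice)
next
  fix l m assume "l \<in> hnf_lattice e n b" "m \<in> hnf_lattice e n b"
  moreover obtain x y x' y' where [simp]: "l = (x, y)" "m = (x', y')" by (cases l, cases m) auto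
  ultimately have "int e dvd y - y'" "int e * int n dvd (x - int b * y) - (x' - int b * y')"
    by (auto simp: mem_hnf_lattice intro: dvd_diff)
  moreover have "(x - int b * y) - (x' - int b * y') = x - x' - int b * (y - y')"
    by (simp add: algebra_simps)
  ultimately show "l - m \<in> hnf_lattice e n b" by (simp only: diff_Pair mem_hnf_lattice \<open>l = _\<close> \<open>m = _\<close> HOL.simp_thms)
next
  fix x y assume xy: "(x, y) \<in> hnf_lattice e n b"
  have "int n dvd int (b\<^sup>2 + b + 1)" using assms by (simp only: of_nat_dvd_iff)
  then have "int e * int n dvd y * int (b\<^sup>2 + b + 1)"
    using xy by (intro mult_dvd_mono) (auto simp: mem_hnf_lattice)
  moreover have "int e * int n dvd (1 + int b) * (x - int b * y)"
    using xy by (simp add: mem_hnf_lattice)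
  ultimately have "int e * int n dvd - ((1 + int b) * (x - int b * y) + y * int (b\<^sup>2 + b + 1))"
    by (simp only: dvd_minus_iff dvd_add)
  also have "- ((1 + int b) * (x - int b * y) + y * int (b\<^sup>2 + b + 1)) = - x - y - int b * x"
    by (simp add: power2_eq_square algebra_simps)
  finally show "(- x - y, x) \<in> hnf_lattice e n b"
    using hnf_lattice_dvd_fst[OF xy] by (simp add: mem_hnf_lattice)
qed

text \<open>The least positive second coordinate \<open>e\<close> and the least positive
  \<open>f\<close> on the first axis give a basis; the given axis vector and its rotation make both
  exist. Rotating moves a first coordinate into second position, so \<open>e\<close> divides all
  coordinates, in particular \<open>f = e * n\<close>. Invariance of the basis vector
  \<open>(e * b, e)\<close> is the congruence for \<open>b\<close>.\<close>

lemma (in rotation_lattice) hnf_exists: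
  assumes a: "(a, 0) \<in> K" "a \<noteq> 0"
  obtains e n b where "e > 0" "b < n" "n dvd b\<^sup>2 + b + 1" "K = hnf_lattice e n b"
proof -
  have pos: "(\<bar>a\<bar>, 0) \<in> K" using a uminus_mem[of "(a, 0)"] by (auto simp: abs_if)
  then have "(- \<bar>a\<bar>, \<bar>a\<bar>) \<in> K" using rho_mem[OF pos] by simp
  then have "\<exists>m. m > 0 \<and> (\<exists>x. (x, int m) \<in> K)"
    using a(2) by (intro exI[of _ "nat \<bar>a\<bar>"]) auto
  then obtain e where e: "e > 0" "\<exists>x. (x, int e) \<in> K"
    and e_least: "\<And>m. m < e \<Longrightarrow> \<not> (m > 0 \<and> (\<exists>x. (x, int m) \<in> K))"
    using exists_least_iff[of "\<lambda>m. m > 0 \<and> (\<exists>x. (x, int m) \<in> K)"] by auto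
  obtain x0 where x0: "(x0, int e) \<in> K" using e by blast
  have e_snd: "int e dvd y" if "(x, y) \<in> K" for x y
  proof -
    have "(x, y) - (y div int e * x0, y div int e * int e) \<in> K"
      using diff_mem[OF that scale_mem[OF x0]] .
    then have "(x - y div int e * x0, int (nat (y mod int e))) \<in> K"
      using e by (simp add: minus_div_mult_eq_mod)
    moreover have "nat (y mod int e) < e" using e by (simp add: nat_less_iff)
    ultimately have "nat (y mod int e) = 0" using e_least by (metis neq0_conv)
    moreover have "y mod int e \<ge> 0" using e by simp
    ultimately show ?thesis by (simp only: dvd_eq_mod_eq_0 nat_eq_iff)
  qed
  have e_fst: "int e dvd x" if "(x, y) \<in> K" for x y
    using e_snd[OF rho_mem[OF that]] .
  have "\<exists>m. m > 0 \<and> (int m, 0) \<in> K"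
    using a(2) pos by (intro exI[of _ "nat \<bar>a\<bar>"]) auto
  then obtain f where f: "f > 0" "(int f, 0) \<in> K"
    and f_least: "\<And>m. m < f \<Longrightarrow> \<not> (m > 0 \<and> (int m, 0) \<in> K)"
    using exists_least_iff[of "\<lambda>m. m > 0 \<and> (int m, 0) \<in> K"] by auto
  have f_dvd: "int f dvd x" if "(x, 0) \<in> K" for x
  proof -
    have "(x, 0) - (x div int f * int f, x div int f * 0) \<in> K"
      using diff_mem[OF that scale_mem[OF f(2)]] .
    then have "(int (nat (x mod int f)), 0) \<in> K"
      using f by (simp add: minus_div_mult_eq_mod)
    moreover have "nat (x mod int f) < f" using f by (simp add: nat_less_iff)
    ultimately have "nat (x mod int f) = 0" using f_least by (metis neq0_conv)
    moreover have "x mod int f \<ge> 0" using f by simp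
    ultimately show ?thesis by (simp only: dvd_eq_mod_eq_0 nat_eq_iff)
  qed
  obtain n where n: "f = e * n" using e_fst[OF f(2)] by (auto simp: of_nat_dvd_iff)
  have npos: "n > 0" using f n by simp
  obtain b0 where b0: "x0 = int e * b0" using e_fst[OF x0] by auto
  \<comment> \<open>Subtracting a multiple of \<open>(f, 0)\<close> from \<open>(x0, e)\<close>
    reduces \<open>b0\<close> modulo \<open>n\<close>, which makes the basis unique.\<close>
  define b where "b = nat (b0 mod int n)"
  have ib: "int b = b0 mod int n" using npos by (simp add: b_def)
  have bn: "b < n" using npos by (simp add: b_def nat_less_iff)
  have base: "(int e * int b, int e) \<in> K"
  proof -
    have "(x0, int e) - (b0 div int n * int f, b0 div int n * 0) \<in> K"
      using diff_mem[OF x0 scale_mem[OF f(2)]] .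
    moreover have "x0 - b0 div int n * int f = int e * int b"
      unfolding ib b0 n by (simp add: minus_div_mult_eq_mod[symmetric] algebra_simps)
    ultimately show ?thesis by simp
  qed
  have K_eq: "K = hnf_lattice e n b"
  proof (intro equalityI subsetI)
    fix l assume "l \<in> K"
    moreover obtain x y where l: "l = (x, y)" by (cases l)
    ultimately have xy: "(x, y) \<in> K" by simp
    obtain k where k: "y = int e * k" using e_snd[OF xy] by auto
    have "(x, y) - (k * (int e * int b), k * int e) \<in> K" using diff_mem[OF xy scale_mem[OF base]] .
    moreover have "x - k * (int e * int b) = x - int b * y" "y - k * int e = 0" using k by simp_all
    ultimately have "(x - int b * y, 0) \<in> K" by simp
    then have "int f dvd x - int b * y" by (rule f_dvd)
    then show "l \<in> hnf_lattice e n b" using e_snd[OF xy] by (simp add: l mem_hnf_lattice n)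
  next
    fix l assume "l \<in> hnf_lattice e n b"
    moreover obtain x y where l: "l = (x, y)" by (cases l)
    ultimately obtain k j where kj: "y = int e * k" "x - int b * y = int f * j"
      by (auto simp: mem_hnf_lattice n dvd_def)
    have "(k * (int e * int b), k * int e) + (j * int f, j * 0) \<in> K"
      by (intro add_mem scale_mem base f(2))
    moreover have "x = k * (int e * int b) + j * int f" using kj by (simp add: algebra_simps)
    ultimately show "l \<in> K" using kj by (simp add: l mult.commute)
  qed
  have "(- (int e * int b) - int e, int e * int b) \<in> hnf_lattice e n b"
    using rho_mem[OF base] by (simp add: K_eq)
  then have "int e * int n dvd - (int e * int b) - int e - int b * (int e * int b)"
    by (simp add: mem_hnf_lattice)
  also have "\<dots> = int e * (- int (b\<^sup>2 + b + 1))" by (simp add: power2_eq_square algebra_simps)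
  finally have "int n dvd - int (b\<^sup>2 + b + 1)" using e by (simp only: dvd_mult_cancel_left) auto
  then have "n dvd b\<^sup>2 + b + 1" by (simp only: dvd_minus_iff of_nat_dvd_iff)
  then show thesis using that e(1) bn K_eq by blast
qed

lemma hnf_lattice_dvdD:
  assumes "hnf_lattice e n b \<subseteq> hnf_lattice e' n' b'"
  shows "e' dvd e" "e' * n' dvd e * n" "int e' * int n' dvd int e * (int b - int b')"
proof -
  have "(int e * int b, int e) \<in> hnf_lattice e n b" "(int e * int n, 0) \<in> hnf_lattice e n b"
    by (simp_all add: mem_hnf_lattice)
  then have "(int e * int b, int e) \<in> hnf_lattice e' n' b'" "(int e * int n, 0) \<in> hnf_lattice e' n' b'"
    using assms by blast+
  then show "e' dvd e" "e' * n' dvd e * n" "int e' * int n' dvd int e * (int b - int b')"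
    by (auto simp: mem_hnf_lattice algebra_simps simp flip: of_nat_mult)
qed

lemma hnf_lattice_inject:
  assumes "hnf_lattice e n b = hnf_lattice e' n' b'" "e > 0" "b < n" "b' < n'"
  shows "e = e' \<and> n = n' \<and> b = b'"
proof -
  have e: "e = e'"
    using hnf_lattice_dvdD(1)[of e n b e' n' b'] hnf_lattice_dvdD(1)[of e' n' b' e n b] assms(1)
    by (simp add: dvd_antisym)
  have "e * n = e' * n'"
    using hnf_lattice_dvdD(2)[of e n b e' n' b'] hnf_lattice_dvdD(2)[of e' n' b' e n b] assms(1)
    by (simp add: dvd_antisym)
  then have n: "n = n'" using e assms(2) by simp
  have "int e * int n dvd int e * (int b - int b')"
    using hnf_lattice_dvdD(3)[of e n b e' n' b'] assms(1) e n by simp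
  then have "int n dvd int b - int b'" using assms(2) by simp
  moreover have "\<bar>int b - int b'\<bar> < int n" using assms(3,4) n by simp
  ultimately have "int b - int b' = 0" using dvd_imp_le_int[of "int b - int b'" "int n"] by force
  then show ?thesis using e n by simp
qed

lemma hnf_lattice_even_iff:
  "(\<forall>(x, y) \<in> hnf_lattice e n b. even x \<and> even y) \<longleftrightarrow> even e"
proof
  assume *: "\<forall>(x, y) \<in> hnf_lattice e n b. even x \<and> even y"
  have "(int e * int b, int e) \<in> hnf_lattice e n b" by (simp add: mem_hnf_lattice)
  then have "even (int e)" using * by blast
  then show "even e" by simp
next
  assume "even e"
  then have "even (int e)" by simp
  then have "even x \<and> even y" if "(x, y) \<in> hnf_lattice e n b" for x y
    using hnf_lattice_dvd_fst[OF that] that by (auto simp only: mem_hnf_lattice intro: dvd_trans)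
  then show "\<forall>(x, y) \<in> hnf_lattice e n b. even x \<and> even y" by blast
qed

lemma hnf_lattice_double:
  "(2 * x, 2 * y) \<in> hnf_lattice (2 * e) n b \<longleftrightarrow> (x, y) \<in> hnf_lattice e n b"
proof -
  have "2 * x - int b * (2 * y) = 2 * (x - int b * y)" "int (2 * e) * int n = 2 * (int e * int n)"
    "int (2 * e) = 2 * int e"
    by (simp_all add: algebra_simps)
  then show ?thesis unfolding mem_hnf_lattice by (simp only: dvd_mult_cancel_left) simp
qed

text \<open>A map \<open>c\<close> whose fibres are the cosets stands for the quotient group;
  vertices will carry such labels. The box is a fundamental domain for the triangular basis.\<close>

lemma card_range_hnf_lattice:
  assumes "\<And>l m. c l = c m \<longleftrightarrow> l - m \<in> hnf_lattice e n b" "e > 0" "n > 0"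
  shows "finite (range c)" "card (range c) = e\<^sup>2 * n"
proof -
  let ?B = "{0..<int (e * n)} \<times> {0..<int e}"
  have "range c = c ` ?B"
  proof (intro equalityI subsetI)
    fix v assume "v \<in> range c"
    then obtain x y where v: "v = c (x, y)" by auto
    define q where "q = y div int e"
    define x' where "x' = x - int b * int e * q"
    have "(x, y) - (x' mod int (e * n), y mod int e) \<in> hnf_lattice e n b"
    proof -
      have "y - y mod int e = int e * q" by (simp add: q_def minus_mod_eq_mult_div)
      moreover have "x' - x' mod int (e * n) = int (e * n) * (x' div int (e * n))"
        by (simp add: minus_mod_eq_mult_div)
      then have "x - x' mod int (e * n) - int b * (int e * q) = int e * int n * (x' div int (e * n))"
        by (simp add: x'_def algebra_simps)
      ultimately show ?thesis by (simp add: mem_hnf_lattice)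
    qed
    then have "v = c (x' mod int (e * n), y mod int e)" using v assms(1) by blast
    moreover have "(x' mod int (e * n), y mod int e) \<in> ?B" using assms by simp
    ultimately show "v \<in> c ` ?B" by blast
  qed auto
  moreover have "inj_on c ?B"
  proof (rule inj_onI, clarify)
    fix x y x' y' assume h: "x \<in> {0..<int (e * n)}" "y \<in> {0..<int e}"
      "x' \<in> {0..<int (e * n)}" "y' \<in> {0..<int e}" "c (x, y) = c (x', y')"
    then have "int e dvd y - y'" "int (e * n) dvd x - x' - int b * (y - y')"
      using assms(1) by (auto simp: mem_hnf_lattice)
    moreover have "\<bar>y - y'\<bar> < int e" using h by auto
    ultimately have y: "y = y'" using dvd_imp_le_int[of "y - y'" "int e"] by force
    moreover have "\<bar>x - x'\<bar> < int (e * n)" using h by auto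
    ultimately have "x = x'"
      using dvd_imp_le_int[of "x - x'" "int (e * n)"] \<open>int (e * n) dvd _\<close> by force
    with y show "x = x' \<and> y = y'" by simp
  qed
  ultimately have "card (range c) = card ?B" "finite (range c)" by (simp_all add: card_image)
  then show "finite (range c)" "card (range c) = e\<^sup>2 * n"
    by (simp_all add: card_cartesian_product power2_eq_square nat_mult_distrib)
qed

text \<open>Halving \<open>hnf_lattice (2 * e) n b\<close> gives \<open>hnf_lattice e n b\<close>,
  which contains it with index 4, and the set is a coset of the halved lattice. Its points will be
  those with a triangle dart in a fixed direction.\<close>

lemma card_half_hnf_lattice:
  assumes c: "\<And>l m. c l = c m \<longleftrightarrow> l - m \<in> hnf_lattice (2 * e) n b" and e: "e > 0" "n > 0"
  shows "card (c ` {(x, y). (2 * (x - u), 2 * (y - v)) \<in> hnf_lattice (2 * e) n b}) = 4"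
proof -
  let ?S = "{(x, y). (2 * (x - u), 2 * (y - v)) \<in> hnf_lattice (2 * e) n b}"
  \<comment> \<open>Coordinates on that coset along the basis \<open>(e * b, e)\<close>,
    \<open>(e * n, 0)\<close>; the class depends only on their parities.\<close>
  define g where "g = (\<lambda>(k, j). c (u + int e * int b * k + int e * int n * j, v + int e * k))"
  have geq: "g (k, j) = g (k', j') \<longleftrightarrow> even (k - k') \<and> even (j - j')" for k j k' j' :: int
  proof -
    have "g (k, j) = g (k', j') \<longleftrightarrow>
        (int e * int b * (k - k') + int e * int n * (j - j'), int e * (k - k')) \<in> hnf_lattice (2 * e) n b"
      unfolding g_def by (simp add: c algebra_simps)
    also have "\<dots> \<longleftrightarrow> int e * 2 dvd int e * (k - k') \<and> (int e * int n) * 2 dvd (int e * int n) * (j - j')"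
      unfolding mem_hnf_lattice by (simp add: algebra_simps)
    also have "\<dots> \<longleftrightarrow> even (k - k') \<and> even (j - j')"
      using e by (simp only: dvd_mult_cancel_left) auto
    finally show ?thesis .
  qed
  have "c ` ?S = g ` ({0, 1} \<times> {0, 1})"
  proof (intro equalityI subsetI)
    fix w assume "w \<in> c ` ?S"
    then obtain x y where w: "w = c (x, y)" "(x - u, y - v) \<in> hnf_lattice e n b"
      using hnf_lattice_double[of "_ - u" "_ - v" e n b] by blast
    then obtain k j where "y - v = int e * k" "x - u - int b * (y - v) = int e * int n * j"
      unfolding mem_hnf_lattice by (elim conjE dvdE)
    then have "x = u + int e * int b * k + int e * int n * j" "y = v + int e * k"
      by (simp_all add: algebra_simps)
    then have "w = g (k, j)" using w by (simp add: g_def)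
    also have "\<dots> = g (k mod 2, j mod 2)" unfolding geq by presburger
    finally show "w \<in> g ` ({0, 1} \<times> {0, 1})" by (auto intro!: imageI simp: mod_2_eq_odd)
  next
    fix w assume "w \<in> g ` ({0, 1} \<times> {0, 1})"
    then obtain k j where "w = g (k, j)" by auto
    moreover have "(int e * int b * k + int e * int n * j, int e * k) \<in> hnf_lattice e n b"
      by (simp add: mem_hnf_lattice algebra_simps)
    then have "(u + int e * int b * k + int e * int n * j, v + int e * k) \<in> ?S"
      by (simp only: mem_Collect_eq case_prod_conv hnf_lattice_double) (simp add: algebra_simps)
    ultimately show "w \<in> c ` ?S" unfolding g_def case_prod_conv by blast
  qed
  moreover have "inj_on g ({0, 1} \<times> {0, 1})"
    by (rule inj_onI) (auto simp: geq)
  ultimately show ?thesis by (simp add: card_image card_cartesian_product)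
qed

text \<open>Labels must be natural numbers, since trihexes are counted over that type. A coset gets
  the least \<open>n\<close> for which \<open>from_nat n\<close> lies in it.\<close>

lemma (in rotation_lattice) labelling_exists:
  obtains c :: "int \<times> int \<Rightarrow> nat" where "\<And>l m. c l = c m \<longleftrightarrow> l - m \<in> K"
proof
  define c where "c l = (LEAST n. l - from_nat n \<in> K)" for l :: "int \<times> int"
  have c: "l - from_nat (c l) \<in> K" for l
    unfolding c_def by (rule LeastI[of _ "to_nat l"]) (use zero_mem in \<open>simp add: zero_prod_def\<close>)
  fix l m
  show "c l = c m \<longleftrightarrow> l - m \<in> K"
  proof
    assume "c l = c m"
    then show "l - m \<in> K" using diff_mem[OF c[of l] c[of m]] by simp
  next
    assume lm: "l - m \<in> K"
    have "l - z \<in> K \<longleftrightarrow> m - z \<in> K" for z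
      using add_mem[OF lm, of "m - z"] diff_mem[OF _ lm, of "l - z"] by auto
    then show "c l = c m" by (simp add: c_def)
  qed
qed

section \<open>Integer iterates\<close>

definition zpow :: "('a \<Rightarrow> 'a) \<Rightarrow> int \<Rightarrow> 'a \<Rightarrow> 'a" where
  "zpow f k = (if k \<ge> 0 then f ^^ nat k else inv_into UNIV f ^^ nat (- k))"

lemma zpow_0 [simp]: "zpow f 0 x = x"
  by (simp add: zpow_def)

lemma zpow_1 [simp]: "zpow f 1 x = f x"
  by (simp add: zpow_def)

lemma zpow_plus_1:
  assumes "bij f"
  shows "zpow f (k + 1) x = f (zpow f k x)"
proof (cases "k \<ge> 0")
  case True
  then show ?thesis by (simp add: zpow_def nat_add_distrib)
next
  case False
  have "f (inv_into UNIV f y) = y" for y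
    using assms by (simp add: bij_is_surj surj_f_inv_f)
  moreover obtain n where "nat (- k) = Suc n" "nat (- (k + 1)) = n"
    using False by (intro that[of "nat (- k) - 1"]) auto
  ultimately show ?thesis using False by (auto simp: zpow_def)
qed

lemma zpow_minus_1:
  assumes "bij f"
  shows "f (zpow f (k - 1) x) = zpow f k x"
  using zpow_plus_1[OF assms, of "k - 1" x] by simp

lemma zpow_closed:
  assumes "bij f" "\<And>x. f x \<in> D \<longleftrightarrow> x \<in> D"
  shows "zpow f k x \<in> D \<longleftrightarrow> x \<in> D"
proof (induction k rule: int_induct[of _ 0])
  case base
  then show ?case by simp
next
  case (step1 i)
  then show ?case using assms by (simp add: zpow_plus_1)
next
  case (step2 i)
  then show ?case using assms(2)[of "zpow f (i - 1) x"] zpow_minus_1[OF assms(1), of i x] by simp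
qed

lemma zpow_shift:
  assumes "bij f" "\<And>k. f (g k) = g (k + 1)"
  shows "zpow f k (g j) = g (j + k)"
proof (induction k rule: int_induct[of _ 0])
  case base
  then show ?case by simp
next
  case (step1 i)
  then show ?case using assms by (simp add: zpow_plus_1 add.assoc)
next
  case (step2 i)
  have "f (zpow f (i - 1) (g j)) = f (g (j + (i - 1)))"
    using step2 assms(2)[of "j + (i - 1)"] by (simp add: zpow_minus_1[OF assms(1)])
  then show ?case using assms(1) by (simp add: bij_is_inj inj_eq)
qed

text \<open>Restricted to \<open>D\<close> because a graph isomorphism commutes with the rotation
  only on darts. The equivalence for \<open>f'\<close> keeps negative iterates inside
  \<open>D\<close> too.\<close>

lemma zpow_intertwine_on:
  assumes "bij f" "bij f'" "\<And>x. x \<in> D \<Longrightarrow> f (g x) = g (f' x)" "\<And>x. f' x \<in> D \<longleftrightarrow> x \<in> D" "x \<in> D"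
  shows "zpow f k (g x) = g (zpow f' k x)"
proof -
  have D: "zpow f' k x \<in> D" for k using zpow_closed[OF assms(2,4)] assms(5) by blast
  have "f (g (zpow f' k x)) = g (zpow f' (k + 1) x)" for k
    using assms(3)[OF D[of k]] by (simp add: zpow_plus_1[OF assms(2)])
  then show ?thesis using zpow_shift[OF assms(1), of "\<lambda>k. g (zpow f' k x)" k 0] by simp
qed

lemma zpow_intertwine:
  assumes "bij f" "bij f'" "\<And>x. f (g x) = g (f' x)"
  shows "zpow f k (g x) = g (zpow f' k x)"
  by (rule zpow_intertwine_on[OF assms(1,2), where D = UNIV]) (simp_all add: assms(3))

lemma zpow_add:
  assumes "bij f"
  shows "zpow f (a + b) x = zpow f a (zpow f b x)"
proof (induction a rule: int_induct[of _ 0])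
  case base
  then show ?case by simp
next
  case (step1 i)
  have "zpow f (i + 1 + b) x = zpow f ((i + b) + 1) x" by (simp add: algebra_simps)
  then show ?case using step1 by (simp only: zpow_plus_1[OF assms])
next
  case (step2 i)
  have "f (zpow f ((i + b) - 1) x) = zpow f (i + b) x" using assms by (rule zpow_minus_1)
  then have "f (zpow f (i - 1 + b) x) = f (zpow f (i - 1) (zpow f b x))"
    using step2 assms by (simp add: zpow_minus_1 algebra_simps)
  then show ?case using assms by (simp add: bij_is_inj inj_eq)
qed

section \<open>The rotation group of the hexagonal tiling\<close>

text \<open>
  The presentation \<open>\<langle>\<sigma>, \<alpha> | \<sigma>\<^sup>3, \<alpha>\<^sup>2, (\<sigma>\<alpha>)\<^sup>6\<rangle>\<close> defines the group of orientation-preserving symmetries of the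
  hexagonal tiling: \<open>\<sigma>\<close> turns about a vertex, \<open>\<alpha>\<close> about the midpoint of an edge and \<open>\<sigma>\<alpha>\<close> about the
  centre of a hexagon.  With the half turns \<open>a\<^sub>i = \<sigma>\<^sup>-\<^sup>i \<alpha> \<sigma>\<^sup>i\<close> about edge midpoints, \<open>h = (\<sigma>\<alpha>)\<^sup>3 = a\<^sub>2 a\<^sub>1 a\<^sub>0\<close>
  is the half turn about the hexagon, and \<open>X = a\<^sub>1 a\<^sub>2\<close> and \<open>Y = a\<^sub>1 a\<^sub>0\<close> generate the translations.
\<close>

locale hexagonal_action =
  fixes \<sigma> \<alpha> :: "'d \<Rightarrow> 'd"
  assumes sigma3 [simp]: "\<sigma> (\<sigma> (\<sigma> x)) = x"
    and alpha2 [simp]: "\<alpha> (\<alpha> x) = x"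
    and phi6: "\<sigma> (\<alpha> (\<sigma> (\<alpha> (\<sigma> (\<alpha> (\<sigma> (\<alpha> (\<sigma> (\<alpha> (\<sigma> (\<alpha> x))))))))))) = x"
begin

definition h :: "'d \<Rightarrow> 'd" where
  "h x = \<sigma> (\<alpha> (\<sigma> (\<alpha> (\<sigma> (\<alpha> x)))))"

definition X :: "'d \<Rightarrow> 'd" where
  "X x = \<sigma> (\<sigma> (\<alpha> (\<sigma> (\<sigma> (\<alpha> (\<sigma> (\<sigma> x)))))))"

definition Y :: "'d \<Rightarrow> 'd" where
  "Y x = \<sigma> (\<sigma> (\<alpha> (\<sigma> (\<alpha> x))))"

definition t :: "int \<times> int \<Rightarrow> 'd \<Rightarrow> 'd" where
  "t l d = zpow X (fst l) (zpow Y (snd l) d)"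

text \<open>The relation \<open>phi6\<close> says that \<open>h\<close> is an involution, and the
  right-hand side is the inverse word.\<close>

lemma h_alt: "h x = \<alpha> (\<sigma> (\<sigma> (\<alpha> (\<sigma> (\<sigma> (\<alpha> (\<sigma> (\<sigma> x))))))))"
proof -
  let ?y = "\<alpha> (\<sigma> (\<sigma> (\<alpha> (\<sigma> (\<sigma> (\<alpha> (\<sigma> (\<sigma> x))))))))"
  have "h (h ?y) = ?y" unfolding h_def by (rule phi6)
  moreover have "h ?y = x" unfolding h_def by simp
  ultimately show ?thesis by simp
qed

lemma alpha_sigma_alpha: "\<alpha> (\<sigma> (\<alpha> (\<sigma> (\<alpha> x)))) = \<sigma> (\<sigma> (\<alpha> (\<sigma> (\<sigma> (\<alpha> (\<sigma> (\<sigma> (\<alpha> (\<sigma> (\<sigma> x))))))))))"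
proof -
  have "\<sigma> (\<sigma> (h x)) = \<alpha> (\<sigma> (\<alpha> (\<sigma> (\<alpha> x))))" by (simp add: h_def)
  then show ?thesis by (simp add: h_alt)
qed

lemma bij_X: "bij X"
  by (rule o_bij[of "\<lambda>x. \<sigma> (\<alpha> (\<sigma> (\<alpha> (\<sigma> x))))"]) (auto simp: X_def fun_eq_iff)

lemma bij_Y: "bij Y"
  by (rule o_bij[of "\<lambda>x. \<alpha> (\<sigma> (\<sigma> (\<alpha> (\<sigma> x))))"]) (auto simp: Y_def fun_eq_iff)

lemma inv_X: "zpow X (-1) x = \<sigma> (\<alpha> (\<sigma> (\<alpha> (\<sigma> x))))"
proof -
  have "X (zpow X (0 - 1) x) = X (\<sigma> (\<alpha> (\<sigma> (\<alpha> (\<sigma> x)))))"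
    unfolding zpow_minus_1[OF bij_X] by (simp add: X_def)
  then show ?thesis using bij_X by (simp add: bij_is_inj inj_eq)
qed

lemma inv_Y: "zpow Y (-1) x = \<alpha> (\<sigma> (\<sigma> (\<alpha> (\<sigma> x))))"
proof -
  have "Y (zpow Y (0 - 1) x) = Y (\<alpha> (\<sigma> (\<sigma> (\<alpha> (\<sigma> x)))))"
    unfolding zpow_minus_1[OF bij_Y] by (simp add: Y_def)
  then show ?thesis using bij_Y by (simp add: bij_is_inj inj_eq)
qed

lemma XY_commute: "X (Y x) = Y (X x)"
  by (simp add: X_def Y_def alpha_sigma_alpha)

lemma zpow_XY_commute: "zpow X a (zpow Y b x) = zpow Y b (zpow X a x)"
proof (rule zpow_intertwine[OF bij_X bij_X])
  show "X (zpow Y b x) = zpow Y b (X x)" for x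
    by (rule zpow_intertwine[OF bij_Y bij_Y, symmetric]) (simp add: XY_commute)
qed

lemma t_zero [simp]: "t 0 d = d"
  by (simp add: t_def)

lemma t_add: "t (l + m) d = t l (t m d)"
  by (simp add: t_def zpow_add bij_X bij_Y zpow_XY_commute)

lemma t_minus_cancel [simp]: "t (- l) (t l d) = d" "t l (t (- l) d) = d"
  by (simp_all flip: t_add)

lemma bij_t: "bij (t l)"
  by (rule o_bij[of "t (- l)"]) (auto simp: fun_eq_iff)

lemma t_eq_iff: "t l d = t m d \<longleftrightarrow> t (l - m) d = d"
proof -
  have "t l d = t m (t (l - m) d)" by (simp flip: t_add)
  then show ?thesis using bij_t[of m] by (simp add: bij_is_inj inj_eq)
qed

lemma zpow_t: "zpow (t (u, v)) k d = t (k * u, k * v) d"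
proof (induction k rule: int_induct[of _ 0])
  case base
  then show ?case using t_zero by (simp add: zero_prod_def)
next
  case (step1 i)
  have "t ((i + 1) * u, (i + 1) * v) d = t ((u, v) + (i * u, i * v)) d" by (simp add: algebra_simps)
  then show ?case using step1 by (simp add: zpow_plus_1[OF bij_t] t_add del: add_Pair)
next
  case (step2 i)
  have "t (u, v) (t ((i - 1) * u, (i - 1) * v) d) = t (i * u, i * v) d"
    by (simp add: algebra_simps flip: t_add)
  then have "t (u, v) (zpow (t (u, v)) (i - 1) d) = t (u, v) (t ((i - 1) * u, (i - 1) * v) d)"
    using step2 by (simp add: zpow_minus_1[OF bij_t])
  then show ?case using bij_t by (simp add: bij_is_inj inj_eq)
qed

text \<open>Conjugation by \<open>g\<close> is additive on translations, so its values on
  \<open>X\<close> and \<open>Y\<close> give a matrix. The three uses below are multiplication by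
  \<open>\<zeta>\<^sup>2\<close>, by \<open>\<zeta>\<^sup>-\<^sup>1\<close> and by -1.\<close>

lemma t_intertwine:
  assumes "\<And>d. X (g d) = g (t (u, u') d)" "\<And>d. Y (g d) = g (t (v, v') d)"
  shows "t (x, y) (g d) = g (t (x * u + y * v, x * u' + y * v') d)"
proof -
  have "zpow Y y (g d) = g (zpow (t (v, v')) y d)"
    by (rule zpow_intertwine) (auto simp: bij_Y bij_t assms)
  moreover have "zpow X x (g e) = g (zpow (t (u, u')) x e)" for e
    by (rule zpow_intertwine) (auto simp: bij_X bij_t assms)
  ultimately have "t (x, y) (g d) = g (zpow (t (u, u')) x (zpow (t (v, v')) y d))"
    by (simp add: t_def)
  then show ?thesis by (simp add: zpow_t flip: t_add)
qed

lemma t_sigma: "t (x, y) (\<sigma> d) = \<sigma> (t (- x - y, x) d)"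
proof -
  have "X (\<sigma> d) = \<sigma> (t (-1, 1) d)" for d
    by (simp add: t_def inv_X) (simp add: X_def Y_def)
  moreover have "Y (\<sigma> d) = \<sigma> (t (-1, 0) d)" for d
    by (simp add: t_def inv_X) (simp add: Y_def)
  ultimately show ?thesis using t_intertwine[of \<sigma> "-1" 1 "-1" 0 x y d] by simp
qed

lemma t_phi: "t (x, y) (\<sigma> (\<alpha> d)) = \<sigma> (\<alpha> (t (x + y, - x) d))"
proof -
  have "X (\<sigma> (\<alpha> d)) = \<sigma> (\<alpha> (t (1, -1) d))" for d
  proof -
    have "t (1, -1) d = zpow Y (-1) (zpow X 1 d)"
      unfolding t_def by (simp only: fst_conv snd_conv zpow_XY_commute)
    then show ?thesis by (simp add: inv_Y) (simp add: X_def)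
  qed
  moreover have "Y (\<sigma> (\<alpha> d)) = \<sigma> (\<alpha> (t (1, 0) d))" for d
    by (simp add: t_def) (simp add: X_def Y_def alpha_sigma_alpha)
  ultimately show ?thesis using t_intertwine[of "\<lambda>d. \<sigma> (\<alpha> d)" 1 "-1" 1 0 x y d] by simp
qed

lemma t_h: "t (x, y) (h d) = h (t (- x, - y) d)"
proof -
  have "X (h d) = h (t (-1, 0) d)" for d
    by (simp add: t_def inv_X h_alt[of "\<sigma> _"]) (simp add: X_def h_def)
  moreover have "Y (h d) = h (t (0, -1) d)" for d
    by (simp add: t_def inv_Y h_def) (simp add: Y_def alpha_sigma_alpha)
  ultimately show ?thesis using t_intertwine[of h "-1" 0 0 "-1" x y d] by simp
qed

text \<open>A product of two half turns is a translation, so the half turn about each of the three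
  edges at a vertex is \<open>h\<close> followed by a translation. The vectors found here and in
  \<open>a1_eq\<close>, \<open>a2_eq\<close> reappear as \<open>dir\<close>.\<close>

lemma a0_eq: "\<alpha> x = t (1, 0) (h x)"
  by (simp add: t_def X_def h_def)

lemma a1_eq: "\<sigma> (\<sigma> (\<alpha> (\<sigma> x))) = t (1, 1) (h x)"
proof -
  have "t (1, 1) (h x) = Y (X (h x))" by (simp add: t_def XY_commute)
  also have "X (h x) = \<alpha> x" by (simp add: a0_eq t_def)
  finally show ?thesis by (simp add: Y_def)
qed

lemma a2_eq: "\<sigma> (\<alpha> (\<sigma> (\<sigma> x))) = t (0, 1) (h x)"
  by (simp add: t_def Y_def h_alt)

text \<open>Since \<open>h\<close> fixes \<open>d\<close>, it acts on the translates of
  \<open>d\<close> by negating the vector, and each half turn about an edge adds its own shift. This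
  is the origin of the adjacency rule \<open>dir i - l\<close>.\<close>

lemma alpha_t:
  assumes "h d = d"
  shows "\<alpha> (t (x, y) d) = t (1 - x, - y) d"
    "\<alpha> (\<sigma> (t (x, y) d)) = \<sigma> (t (1 - x, 1 - y) d)"
    "\<alpha> (\<sigma> (\<sigma> (t (x, y) d))) = \<sigma> (\<sigma> (t (- x, 1 - y) d))"
proof -
  have h: "h (t (x, y) d) = t (- x, - y) d"
    using t_h[of "- x" "- y" d] assms by simp
  show "\<alpha> (t (x, y) d) = t (1 - x, - y) d"
    by (simp add: a0_eq h flip: t_add)
  have "\<sigma> (\<sigma> (\<alpha> (\<sigma> (t (x, y) d)))) = t (1 - x, 1 - y) d"
    by (simp add: a1_eq h flip: t_add)
  from arg_cong[OF this, of \<sigma>] show "\<alpha> (\<sigma> (t (x, y) d)) = \<sigma> (t (1 - x, 1 - y) d)" by simp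
  have "\<sigma> (\<alpha> (\<sigma> (\<sigma> (t (x, y) d)))) = t (- x, 1 - y) d"
    by (simp add: a2_eq h flip: t_add)
  from arg_cong[OF this, of "\<lambda>x. \<sigma> (\<sigma> x)"]
  show "\<alpha> (\<sigma> (\<sigma> (t (x, y) d))) = \<sigma> (\<sigma> (t (- x, 1 - y) d))" by simp
qed

end

text \<open>The relations are required on the whole type, freeness only on the darts
  \<open>D\<close>. Given \<open>phi6\<close>, the condition \<open>phi2_free\<close> excludes faces
  with one or two sides.\<close>

locale trihex_action = hexagonal_action +
  fixes D
  assumes sigma_D [simp]: "\<sigma> d \<in> D \<longleftrightarrow> d \<in> D"
    and alpha_D [simp]: "\<alpha> d \<in> D \<longleftrightarrow> d \<in> D"
    and sigma_free: "d \<in> D \<Longrightarrow> \<sigma> d \<noteq> d"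
    and alpha_free: "d \<in> D \<Longrightarrow> \<alpha> d \<noteq> d"
    and phi2_free: "d \<in> D \<Longrightarrow> \<sigma> (\<alpha> (\<sigma> (\<alpha> d))) \<noteq> d"
begin

lemma t_D [simp]: "t l d \<in> D \<longleftrightarrow> d \<in> D"
  by (simp add: t_def zpow_closed bij_X bij_Y X_def Y_def)

text \<open>
  A composite of \<open>\<sigma>\<close> and a translation is a rotation of order 3, so up to conjugation by translations
  it is one of \<open>\<sigma>\<close>, \<open>\<alpha>\<sigma>\<alpha>\<close> and \<open>(\<sigma>\<alpha>)\<^sup>-\<^sup>2\<close>.
\<close>

lemma sigma_t_neq:
  assumes "d \<in> D"
  shows "\<sigma> (t m d) \<noteq> t l d"
proof
  assume eq: "\<sigma> (t m d) = t l d"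
  obtain p q where pq: "m - l = (p, q)" by (cases "m - l")
  have shift: "\<sigma> (t (p - 2 * x - y, q + x - y) e) = e" if e: "e = t (l + (x, y)) d" for x y e
  proof -
    have "e = t (x, y) (\<sigma> (t m d))" using e eq by (simp add: t_add add.commute[of l])
    also have "\<dots> = \<sigma> (t ((- x - y, x) + m) d)" by (simp only: t_sigma t_add)
    also have "(- x - y, x) + m = (p - 2 * x - y, q + x - y) + (l + (x, y))"
      using pq by (cases m; cases l) auto
    finally show ?thesis using e by (simp add: t_add)
  qed
  \<comment> \<open>In \<open>shift\<close>, the difference of the two coordinates changes by
    \<open>- 3 * x\<close>, so a choice of \<open>x\<close> and \<open>y\<close> leaves only the
    residue \<open>r\<close> of \<open>p - q\<close> modulo 3. Its three values give the three types
    of rotation.\<close>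
  define k where "k = (p - q + 1) div 3"
  define r where "r = p - q - 3 * k"
  have r: "r = 0 \<or> r = 1 \<or> r = -1" unfolding r_def k_def by presburger
  have pk: "p = q + 3 * k + r" by (simp add: r_def)
  from r show False
  proof (elim disjE)
    assume "r = 0"
    then have "\<sigma> (t (0, 0) (t (l + (k, q + k)) d)) = t (l + (k, q + k)) d"
      using shift[OF refl, of k "q + k"] pk by (simp add: algebra_simps)
    then show False using sigma_free assms by (simp flip: zero_prod_def)
  next
    assume "r = 1"
    let ?e = "t (l + (k, q + k)) d"
    have "\<sigma> (t (1, 0) ?e) = ?e" using shift[OF refl, of k "q + k"] pk \<open>r = 1\<close> by simp
    then have "\<sigma> (X ?e) = ?e" by (simp add: t_def)
    then have "\<alpha> (\<sigma> (\<sigma> (\<alpha> (\<sigma> (\<sigma> ?e))))) = ?e" by (simp add: X_def)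
    then have "\<sigma> (\<alpha> (\<sigma> (\<alpha> ?e))) = ?e" by (metis sigma3 alpha2)
    then show False using phi2_free assms by simp
  next
    assume "r = -1"
    let ?e = "t (l + (k, q + k - 1)) d"
    have "\<sigma> (t (0, 1) ?e) = ?e" using shift[OF refl, of k "q + k - 1"] pk \<open>r = -1\<close> by simp
    then have "\<alpha> (\<sigma> (\<alpha> ?e)) = ?e" by (simp add: t_def Y_def)
    then have "\<sigma> (\<alpha> ?e) = \<alpha> ?e" by (metis alpha2)
    then show False using sigma_free assms by simp
  qed
qed

text \<open>
  If \<open>h\<close> and an odd translation fix a dart, then so does their product, which is conjugate to \<open>\<alpha>\<close>.
\<close>

lemma t_fixed_even:
  assumes "d \<in> D" "h d = d" "t (x, y) d = d"
  shows "even x" "even y"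
proof -
  have "\<not> (t (a, b) d = d \<and> (odd a \<or> odd b))" for a b
  proof
    assume "t (a, b) d = d \<and> (odd a \<or> odd b)"
    then have fx: "t (a, b) d = d" and od: "odd a \<or> odd b" by auto
    \<comment> \<open>Half of \<open>(a, b)\<close>, rounded up: subtracting \<open>(a, b)\<close>
      gives the vector that \<open>alpha_t\<close> assigns to the reversal of one of the three darts
      at \<open>?e\<close>. Two even entries would give the vector of \<open>h\<close> itself and no
      contradiction.\<close>
    let ?i = "(a + 1) div 2" and ?j = "(b + 1) div 2"
    let ?e = "t (?i, ?j) d"
    have neg: "t (p - a, q - b) d = t (p, q) d" for p q
    proof -
      have "t (p, q) d = t (p - a, q - b) (t (a, b) d)" by (simp flip: t_add)
      then show ?thesis by (simp add: fx)
    qed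
    have "?i - a = (if odd a then 1 - ?i else - ?i)" "?j - b = (if odd b then 1 - ?j else - ?j)"
      by presburger+
    then consider "?i - a = 1 - ?i" "?j - b = - ?j" | "?i - a = 1 - ?i" "?j - b = 1 - ?j"
      | "?i - a = - ?i" "?j - b = 1 - ?j"
      using od by metis
    then show False
    proof cases
      case 1
      have "\<alpha> ?e = t (1 - ?i, - ?j) d" using assms(2) by (simp add: alpha_t)
      also have "\<dots> = ?e" using neg[of ?i ?j] 1 by simp
      finally show False using alpha_free assms by simp
    next
      case 2
      have "\<alpha> (\<sigma> ?e) = \<sigma> (t (1 - ?i, 1 - ?j) d)" using assms(2) by (simp add: alpha_t)
      also have "t (1 - ?i, 1 - ?j) d = ?e" using neg[of ?i ?j] 2 by simp
      finally show False using alpha_free assms by simp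
    next
      case 3
      have "\<alpha> (\<sigma> (\<sigma> ?e)) = \<sigma> (\<sigma> (t (- ?i, 1 - ?j) d))" using assms(2) by (simp add: alpha_t)
      also have "t (- ?i, 1 - ?j) d = ?e" using neg[of ?i ?j] 3 by simp
      finally show False using alpha_free assms by simp
    qed
  qed
  then show "even x" "even y" using assms(3) by blast+
qed

end

section \<open>The action on the darts of a trihex\<close>

lemma trihexD:
  assumes "trihex M"
  shows "pair_graph (skeleton M)" "Digraph_Component.connected (skeleton M)" "rot M permutes parcs (skeleton M)"
    "finite (pverts (skeleton M))" "finite (parcs (skeleton M))"
    "\<And>d. d \<in> parcs (skeleton M) \<Longrightarrow> fst d \<in> pverts (skeleton M)"
    "\<And>d. prod.swap d \<in> parcs (skeleton M) \<longleftrightarrow> d \<in> parcs (skeleton M)"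
    "\<And>d. rot M d \<in> parcs (skeleton M) \<longleftrightarrow> d \<in> parcs (skeleton M)"
    "\<And>d. d \<in> parcs (skeleton M) \<Longrightarrow> prod.swap d \<noteq> d"
proof -
  show pg: "pair_graph (skeleton M)" and "Digraph_Component.connected (skeleton M)"
    and perm: "rot M permutes parcs (skeleton M)"
    using assms by (auto simp: trihex_def plane_graph_def rotation_system_def)
  then interpret pair_graph "skeleton M" by simp
  show "finite (pverts (skeleton M))" "finite (parcs (skeleton M))" by simp_all
  show "fst d \<in> pverts (skeleton M)" if "d \<in> parcs (skeleton M)" for d
    using that by (rule arc_fst_in_verts)
  show "prod.swap d \<in> parcs (skeleton M) \<longleftrightarrow> d \<in> parcs (skeleton M)" for d
    using pair_sym_arcs arcs_ends_symmetric[of "with_proj (skeleton M)"] by (cases d) auto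
  show "rot M d \<in> parcs (skeleton M) \<longleftrightarrow> d \<in> parcs (skeleton M)" for d
    using perm by (rule permutes_in_image)
  show "prod.swap d \<noteq> d" if "d \<in> parcs (skeleton M)" for d
    using pair_no_loops[OF that] by (cases d) auto
qed

lemma trihex_out_arcs:
  assumes "trihex M" "d \<in> parcs (skeleton M)"
  shows "out_arcs (skeleton M) (fst d) = orbit (rot M) d" "card (orbit (rot M) d) = 3"
    "d \<in> orbit (rot M) d"
proof -
  have d: "d \<in> out_arcs (skeleton M) (fst d)" using assms by simp
  then have "cyclic_on (rot M) (out_arcs (skeleton M) (fst d))"
    using assms(1) trihexD(6)[OF assms]
    unfolding trihex_def plane_graph_def rotation_system_def by blast
  then show eq: "out_arcs (skeleton M) (fst d) = orbit (rot M) d"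
    using d orbit_cyclic_eq3 by metis
  show "card (orbit (rot M) d) = 3"
    using assms trihexD(6)[OF assms] unfolding eq[symmetric] trihex_def regular_def out_degree_def by auto
  show "d \<in> orbit (rot M) d" using d eq by simp
qed

lemma trihex_face_orbit:
  assumes "trihex M" "d \<in> parcs (skeleton M)"
  shows "d \<in> orbit (face_succ M) d"
    "card (orbit (face_succ M) d) = 3 \<or> card (orbit (face_succ M) d) = 6"
proof -
  show "card (orbit (face_succ M) d) = 3 \<or> card (orbit (face_succ M) d) = 6"
    using assms by (auto simp: trihex_def faces_def sides_def)
  have "inj (face_succ M)"
    unfolding face_succ_def using trihexD(3)[OF assms(1)] by (intro inj_compose) (auto simp: permutes_inj)
  moreover have "(face_succ M ^^ n) d \<in> parcs (skeleton M)" for n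
    using assms(2) by (induction n) (auto simp: face_succ_def trihexD[OF assms(1)] simp del: swap_simp)
  then have "finite {y. \<exists>n. y = (face_succ M ^^ n) d}"
    by (intro finite_subset[OF _ trihexD(5)[OF assms(1)]]) auto
  ultimately obtain n where "n > 0" "(face_succ M ^^ n) d = d" by (rule funpow_inj_finite)
  then show "d \<in> orbit (face_succ M) d" by (intro self_in_orbitI)
qed

lemma funpow_3: "(f ^^ 3) x = f (f (f x))"
  by (simp add: numeral_3_eq_3)

text \<open>The face lengths 3 and 6 divide 6 but not 2, which yields \<open>phi6\<close> and
  \<open>phi2_free\<close>. Off the darts the rotation is the identity and the long word collapses
  to six swaps.\<close>

lemma trihex_action_darts:
  assumes "trihex M"
  shows "trihex_action (rot M) prod.swap (parcs (skeleton M))"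
proof
  note D = trihexD[OF assms]
  have out: "(rot M ^^ k) d = d \<longleftrightarrow> 3 dvd k" if "d \<in> parcs (skeleton M)" for d k
    using funpow_eq_self_iff[OF trihex_out_arcs(3)[OF assms that]] trihex_out_arcs(2)[OF assms that] by simp
  have face: "(face_succ M ^^ k) d = d \<longleftrightarrow> card (orbit (face_succ M) d) dvd k" if "d \<in> parcs (skeleton M)" for d k
    using funpow_eq_self_iff[OF trihex_face_orbit(1)[OF assms that]] .
  fix d
  show "rot M (rot M (rot M d)) = d"
    using out[of d 3] permutes_not_in[OF D(3), of d] by (cases "d \<in> parcs (skeleton M)") (auto simp: funpow_3)
  show "prod.swap (prod.swap d) = d" by simp
  show "rot M (prod.swap (rot M (prod.swap (rot M (prod.swap (rot M (prod.swap (rot M (prod.swap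
      (rot M (prod.swap d))))))))))) = d"
  proof (cases "d \<in> parcs (skeleton M)")
    case True
    then have "(face_succ M ^^ 6) d = d"
      unfolding face[OF True] using trihex_face_orbit(2)[OF assms True] by auto
    then show ?thesis by (simp add: face_succ_def numeral_eq_Suc)
  next
    case False
    then have "rot M d = d" "rot M (prod.swap d) = prod.swap d"
      using permutes_not_in[OF D(3)] D(7) by auto
    then show ?thesis by simp
  qed
  show "rot M d \<in> parcs (skeleton M) \<longleftrightarrow> d \<in> parcs (skeleton M)"
    "prod.swap d \<in> parcs (skeleton M) \<longleftrightarrow> d \<in> parcs (skeleton M)" by (rule D)+
  assume d: "d \<in> parcs (skeleton M)"
  show "rot M d \<noteq> d" using out[OF d, of 1] by auto
  show "prod.swap d \<noteq> d" using D(9)[OF d] .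
  have "\<not> card (orbit (face_succ M) d) dvd 2" using trihex_face_orbit(2)[OF assms d] by auto
  then have "(face_succ M ^^ 2) d \<noteq> d" using face[OF d] by blast
  then show "rot M (prod.swap (rot M (prod.swap d))) \<noteq> d"
    by (simp add: face_succ_def numeral_2_eq_2)
qed

lemma card_darts:
  assumes "finite (pverts (skeleton M))" "finite (parcs (skeleton M))"
    "\<And>d. d \<in> parcs (skeleton M) \<Longrightarrow> fst d \<in> pverts (skeleton M)" "regular 3 M"
  shows "card (parcs (skeleton M)) = 3 * card (pverts (skeleton M))"
proof -
  let ?V = "pverts (skeleton M)" and ?A = "parcs (skeleton M)"
  have sub: "fst ` ?A \<subseteq> ?V" using assms(3) by blast
  have "card ?A = (\<Sum>v\<in>?V. \<Sum>d | d \<in> ?A \<and> fst d = v. 1)"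
    using sum.group[OF assms(2,1) sub, of "\<lambda>_. 1 :: nat"] by simp
  also have "\<dots> = (\<Sum>v\<in>?V. 3)"
    using assms(4) by (intro sum.cong) (auto simp: regular_def out_degree_def out_arcs_def)
  finally show ?thesis by simp
qed

lemma even_card_darts:
  assumes "finite (parcs (skeleton M))"
    "\<And>d. d \<in> parcs (skeleton M) \<Longrightarrow> prod.swap d \<in> parcs (skeleton M)"
    "\<And>d. d \<in> parcs (skeleton M) \<Longrightarrow> prod.swap d \<noteq> d"
  shows "even (card (parcs (skeleton M)))"
proof (rule prime_dvd_card_if_no_fixpoint[of _ _ prod.swap])
  show "(prod.swap ^^ 2) d = d" for d :: "'a \<times> 'a" by (simp add: numeral_2_eq_2)
qed (auto simp: assms simp del: swap_simp)

text \<open>Double counting of darts turns Euler's formula into a count of darts on triangles.\<close>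

lemma euler_char_eq_2_iff:
  assumes fin: "finite (parcs (skeleton M))"
    and closed: "\<And>d. d \<in> parcs (skeleton M) \<Longrightarrow> face_succ M d \<in> parcs (skeleton M)"
    and self: "\<And>d. d \<in> parcs (skeleton M) \<Longrightarrow> d \<in> orbit (face_succ M) d"
    and sides: "\<And>d. d \<in> parcs (skeleton M) \<Longrightarrow>
      card (orbit (face_succ M) d) = 3 \<or> card (orbit (face_succ M) d) = 6"
    and darts: "card (parcs (skeleton M)) = 3 * card (pverts (skeleton M))"
    and even: "even (card (parcs (skeleton M)))"
  shows "euler_char M = 2 \<longleftrightarrow> card {d \<in> parcs (skeleton M). (face_succ M ^^ 3) d = d} = 12"
proof -
  have "6 * card (faces M) = card (parcs (skeleton M)) + card {d \<in> parcs (skeleton M). (face_succ M ^^ 3) d = d}"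
    unfolding faces_def by (rule six_card_orbits[OF fin self closed sides])
  moreover obtain k where "card (parcs (skeleton M)) = 2 * k" using even by blast
  \<comment> \<open>With \<open>V\<close> vertices, \<open>3 * V\<close> darts, \<open>F\<close>
    faces and \<open>T\<close> triangle darts, \<open>6 * F = 3 * V + T\<close>, so the Euler
    characteristic \<open>V - 3 * V / 2 + F\<close> equals \<open>T / 6\<close>.\<close>
  ultimately show ?thesis unfolding euler_char_def using darts by auto
qed

lemma trihex_card_triangle_darts:
  assumes "trihex M"
  shows "card {d \<in> parcs (skeleton M). (face_succ M ^^ 3) d = d} = 12"
proof -
  note D = trihexD[OF assms]
  have "card (parcs (skeleton M)) = 3 * card (pverts (skeleton M))"
    using assms by (intro card_darts D) (auto simp: trihex_def)
  moreover have "even (card (parcs (skeleton M)))"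
    by (rule even_card_darts) (auto simp: D simp del: swap_simp)
  moreover have "euler_char M = 2" using assms by (simp add: trihex_def plane_graph_def)
  ultimately show ?thesis
    by (subst euler_char_eq_2_iff[symmetric])
      (auto simp: D face_succ_def trihex_face_orbit[OF assms, unfolded face_succ_def] simp del: swap_simp)
qed

lemma connected_closed_eq:
  assumes "pair_graph G" "Digraph_Component.connected G" "v \<in> W" "W \<subseteq> pverts G"
    and "\<And>u w. u \<in> W \<Longrightarrow> (u, w) \<in> parcs G \<Longrightarrow> w \<in> W"
  shows "W = pverts G"
proof -
  interpret pair_graph G by fact
  have "w \<in> W" if "w \<in> pverts G" for w
  proof -
    have "v \<rightarrow>\<^sup>*\<^bsub>with_proj (mk_symmetric (with_proj G))\<^esub> w"
      using assms(2,3,4) that unfolding connected_def strongly_connected_def by auto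
    then have "v \<rightarrow>\<^sup>*\<^bsub>with_proj G\<^esub> w"
      using reachable_mk_symmetric_eq pair_sym_arcs by blast
    then show ?thesis
      by (induction rule: reachable_induct) (use assms in auto)
  qed
  then show ?thesis using assms(4) by blast
qed

lemma t_equivariant:
  assumes "trihex_action \<sigma> \<alpha> D" "trihex_action \<sigma>' \<alpha>' D'"
    and \<sigma>: "\<And>d. d \<in> D \<Longrightarrow> F (\<sigma> d) = \<sigma>' (F d)" and \<alpha>: "\<And>d. d \<in> D \<Longrightarrow> F (\<alpha> d) = \<alpha>' (F d)"
    and d: "d \<in> D"
  shows "F (hexagonal_action.t \<sigma> \<alpha> l d) = hexagonal_action.t \<sigma>' \<alpha>' l (F d)"
proof -
  interpret A: trihex_action \<sigma> \<alpha> D by fact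
  interpret B: trihex_action \<sigma>' \<alpha>' D' by fact
  have "zpow B.X k (F d) = F (zpow A.X k d)" if "d \<in> D" for k d
    by (rule zpow_intertwine_on[OF B.bij_X A.bij_X _ _ that]) (simp_all add: A.X_def B.X_def \<sigma> \<alpha>)
  moreover have "zpow B.Y k (F d) = F (zpow A.Y k d)" "zpow A.Y k d \<in> D" if "d \<in> D" for k d
  proof -
    show "zpow B.Y k (F d) = F (zpow A.Y k d)"
      by (rule zpow_intertwine_on[OF B.bij_Y A.bij_Y _ _ that]) (simp_all add: A.Y_def B.Y_def \<sigma> \<alpha>)
    show "zpow A.Y k d \<in> D" using zpow_closed[OF A.bij_Y, of D] that by (simp add: A.Y_def)
  qed
  ultimately show ?thesis using d by (simp add: A.t_def B.t_def)
qed

section \<open>Labelling the vertices by lattice points\<close>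

text \<open>
  A half turn about a hexagon swaps the two translation classes of vertices of the tiling, so every
  vertex of the quotient is the image of exactly one class of lattice points, and the three neighbours
  of the vertex \<open>l\<close> are \<open>dir i - l\<close>.
\<close>

definition dir :: "nat \<Rightarrow> int \<times> int" where
  "dir i = (if i mod 3 = 0 then (1, 0) else if i mod 3 = 1 then (1, 1) else (0, 1))"

text \<open>The direction counts modulo 3; leaving it unbounded makes the rotation a plain
  \<open>Suc\<close>.\<close>

definition dart :: "(int \<times> int \<Rightarrow> 'a) \<Rightarrow> int \<times> int \<Rightarrow> nat \<Rightarrow> 'a \<times> 'a" where
  "dart c l i = (c l, c (dir i - l))"

definition labelling :: "(int \<times> int) set \<Rightarrow> (int \<times> int \<Rightarrow> 'a) \<Rightarrow> 'a embedded_graph \<Rightarrow> bool" where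
  "labelling K c M \<longleftrightarrow> (\<forall>l m. c l = c m \<longleftrightarrow> l - m \<in> K) \<and> pverts (skeleton M) = range c \<and>
     parcs (skeleton M) = (\<Union>l. range (dart c l)) \<and> (\<forall>l i. rot M (dart c l i) = dart c l (Suc i))"

lemma labellingD:
  assumes "labelling K c M"
  shows "c l = c m \<longleftrightarrow> l - m \<in> K" "pverts (skeleton M) = range c"
    "parcs (skeleton M) = (\<Union>l. range (dart c l))" "rot M (dart c l i) = dart c l (Suc i)"
    "dart c l i \<in> parcs (skeleton M)"
  using assms unfolding labelling_def by blast+

lemma labelling_dartE:
  assumes "labelling K c M" "a \<in> parcs (skeleton M)"
  obtains l i where "a = dart c l i"
  using assms unfolding labelling_def by blast

lemma dir_mod: "i mod 3 = j mod 3 \<Longrightarrow> dir i = dir j"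
  by (simp add: dir_def)

lemma dart_mod: "i mod 3 = j mod 3 \<Longrightarrow> dart c l i = dart c l j"
  by (simp add: dart_def dir_mod[of i j])

lemma swap_dart: "prod.swap (dart c l i) = dart c (dir i - l) i"
  by (simp add: dart_def)

text \<open>Everything in a labelled graph is a formula in lattice points, so equal labels can be
  matched: the lattice determines the trihex.\<close>

lemma labelling_iso:
  assumes "labelling K c M" "labelling K c' N"
  shows "\<exists>f. oriented_iso f M N"
proof
  \<comment> \<open>Any representative serves, because \<open>c\<close> and \<open>c'\<close> have
    the same fibres.\<close>
  define f where "f v = c' (SOME l. c l = v)" for v
  have f: "f (c l) = c' l" for l
  proof -
    have "c (SOME m. c m = c l) = c l" by (rule someI) simp
    then show ?thesis using assms unfolding f_def labelling_def by metis
  qed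
  have dart: "map_prod f f (dart c l i) = dart c' l i" for l i by (simp add: dart_def f)
  show "oriented_iso f M N"
    unfolding oriented_iso_def
  proof (intro conjI ballI)
    show "bij_betw f (pverts (skeleton M)) (pverts (skeleton N))"
    proof (rule bij_betw_imageI)
      show "inj_on f (pverts (skeleton M))"
        unfolding labellingD(2)[OF assms(1)]
        by (auto simp only: f labellingD(1)[OF assms(1)] labellingD(1)[OF assms(2)] intro!: inj_onI)
      show "f ` pverts (skeleton M) = pverts (skeleton N)"
        by (simp add: labellingD(2)[OF assms(1)] labellingD(2)[OF assms(2)] f image_image)
    qed
    show "map_prod f f ` parcs (skeleton M) = parcs (skeleton N)"
      by (simp add: labellingD(3)[OF assms(1)] labellingD(3)[OF assms(2)] image_UN image_image dart)
    fix a assume "a \<in> parcs (skeleton M)"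
    then obtain l i where "a = dart c l i" using assms(1) labelling_dartE by metis
    then show "map_prod f f (rot M a) = rot N (map_prod f f a)"
      by (simp add: labellingD(4)[OF assms(1)] labellingD(4)[OF assms(2)] dart)
  qed
qed

text \<open>Translation by \<open>l\<close> adds \<open>l\<close> to the label of a dart of
  direction 0; for direction \<open>i\<close> the vector is first rotated \<open>i\<close> times,
  which does not affect membership in \<open>K\<close>. Hence \<open>K\<close> can be recovered from
  any dart.\<close>

lemma t_fixes_dart_iff:
  assumes "trihex M" "labelling K c M" "rotation_lattice K"
  shows "hexagonal_action.t (rot M) prod.swap l (dart c m i) = dart c m i \<longleftrightarrow> l \<in> K"
proof -
  interpret trihex_action "rot M" prod.swap "parcs (skeleton M)" using assms(1) by (rule trihex_action_darts)
  interpret rotation_lattice K by fact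
  have rot: "rot M (dart c l i) = dart c l (Suc i)" for l i using assms(2) by (rule labellingD)
  have c: "c l = c m \<longleftrightarrow> l - m \<in> K" for l m using assms(2) by (rule labellingD)
  have X: "X (dart c m 0) = dart c (m + (1, 0)) 0" for m
  proof -
    have "X (dart c m 0) = dart c (dir 4 - (dir 2 - m)) 6"
      by (simp add: X_def rot swap_dart eval_nat_numeral del: swap_simp)
    also have "dir 4 - (dir 2 - m) = m + (1, 0)" by (cases m) (simp add: dir_def)
    finally show ?thesis by (simp add: dart_mod[of 6 0])
  qed
  have Y: "Y (dart c m 0) = dart c (m + (0, 1)) 0" for m
  proof -
    have "Y (dart c m 0) = dart c (dir 1 - (dir 0 - m)) 3"
      by (simp add: Y_def rot swap_dart eval_nat_numeral del: swap_simp)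
    also have "dir 1 - (dir 0 - m) = m + (0, 1)" by (cases m) (simp add: dir_def)
    finally show ?thesis by (simp add: dart_mod[of 3 0])
  qed
  have zX: "zpow X k (dart c m 0) = dart c (m + (k, 0)) 0" for k m
    using zpow_shift[OF bij_X, of "\<lambda>k. dart c (m + (k, 0)) 0" k 0] X by (simp add: add.assoc flip: zero_prod_def)
  have zY: "zpow Y k (dart c m 0) = dart c (m + (0, k)) 0" for k m
    using zpow_shift[OF bij_Y, of "\<lambda>k. dart c (m + (0, k)) 0" k 0] Y by (simp add: add.assoc flip: zero_prod_def)
  show ?thesis
  proof (induction i arbitrary: l)
    case 0
    have "t l (dart c m 0) = dart c (m + l) 0" by (cases l) (simp add: t_def zX zY add.assoc)
    then show ?case by (auto simp: dart_def c uminus_mem_iff)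
  next
    case (Suc i)
    obtain x y where l: "l = (x, y)" by (cases l)
    have "t (x, y) (rot M (dart c m i)) = rot M (dart c m i) \<longleftrightarrow> t (- x - y, x) (dart c m i) = dart c m i"
      unfolding t_sigma by (metis sigma3)
    then show ?case using Suc[of "(- x - y, x)"] by (simp add: l rot rho_mem_iff)
  qed
qed

text \<open>An isomorphism commutes with translations, so a dart and its image have the same
  stabiliser. The image may be any dart of \<open>N\<close>, which is why
  \<open>t_fixes_dart_iff\<close> covers all of them.\<close>

lemma iso_same_lattice:
  assumes "trihex M" "labelling K c M" "rotation_lattice K"
    "trihex N" "labelling K' c' N" "rotation_lattice K'" "oriented_iso f M N"
  shows "K = K'"
proof -
  let ?F = "map_prod f f" and ?d = "dart c 0 0"
  let ?t = "hexagonal_action.t (rot M) prod.swap" and ?t' = "hexagonal_action.t (rot N) prod.swap"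
  interpret trihex_action "rot M" prod.swap "parcs (skeleton M)" using assms(1) by (rule trihex_action_darts)
  have d: "?d \<in> parcs (skeleton M)" using assms(2) by (rule labellingD)
  then have "?F ?d \<in> parcs (skeleton N)" using assms(7) unfolding oriented_iso_def by blast
  then obtain m i where Fd: "?F ?d = dart c' m i" using assms(5) labelling_dartE by metis
  have verts: "fst a \<in> pverts (skeleton M) \<and> snd a \<in> pverts (skeleton M)" if "a \<in> parcs (skeleton M)" for a
    using that trihexD(6,7)[OF assms(1), of "prod.swap a"] trihexD(6)[OF assms(1)] by (cases a) auto
  have "inj_on f (pverts (skeleton M))" using assms(7) by (auto simp: oriented_iso_def bij_betw_def)
  then have inj: "?F a = ?F b \<longleftrightarrow> a = b" if "a \<in> parcs (skeleton M)" "b \<in> parcs (skeleton M)" for a b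
    using verts[OF that(1)] verts[OF that(2)] by (cases a; cases b) (auto dest: inj_onD)
  have "?F (?t l ?d) = ?t' l (?F ?d)" for l
    by (rule t_equivariant[OF trihex_action_darts[OF assms(1)] trihex_action_darts[OF assms(4)] _ _ d])
      (use assms(7) in \<open>auto simp: oriented_iso_def\<close>)
  then have "?t l ?d = ?d \<longleftrightarrow> ?t' l (?F ?d) = ?F ?d" for l
    using inj[of "?t l ?d" ?d] d by simp
  then have "l \<in> K \<longleftrightarrow> l \<in> K'" for l
    unfolding Fd t_fixes_dart_iff[OF assms(1-3)] t_fixes_dart_iff[OF assms(4-6)] .
  then show ?thesis by blast
qed

text \<open>The induced permutation of the four faces has period 3 and so fixes one; there
  \<open>f\<close> acts as a power of \<open>face_succ\<close>. The trivial power remains possible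
  here and is excluded later by a moved vertex.\<close>

lemma three_fold_triangle:
  assumes "trihex M" and iso: "oriented_iso f M M"
    and f3: "\<And>v. v \<in> pverts (skeleton M) \<Longrightarrow> f (f (f v)) = v"
  obtains d where "d \<in> parcs (skeleton M)" "(face_succ M ^^ 3) d = d"
    "map_prod f f d \<in> {d, face_succ M d, face_succ M (face_succ M d)}"
proof -
  let ?F = "map_prod f f" and ?D = "parcs (skeleton M)" and ?p = "face_succ M"
  let ?D3 = "{d \<in> ?D. (?p ^^ 3) d = d}"
  note D = trihexD[OF assms(1)]
  have FD: "?F d \<in> ?D" if "d \<in> ?D" for d using iso that by (auto simp: oriented_iso_def)
  have pD: "?p d \<in> ?D" if "d \<in> ?D" for d using that by (simp add: face_succ_def D del: swap_simp)
  have F3: "?F (?F (?F d)) = d" if "d \<in> ?D" for d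
    using that f3 D(6)[OF that] D(6)[of "prod.swap d"] D(7)[of d] by (cases d) auto
  have Fp: "?F (?p d) = ?p (?F d)" if "d \<in> ?D" for d
  proof -
    have "prod.swap d \<in> ?D" using that D(7) by blast
    then have "?F (rot M (prod.swap d)) = rot M (?F (prod.swap d))" using iso by (auto simp: oriented_iso_def)
    then show ?thesis by (cases d) (simp add: face_succ_def)
  qed
  have Fpn: "?F ((?p ^^ n) d) = (?p ^^ n) (?F d) \<and> (?p ^^ n) d \<in> ?D" if "d \<in> ?D" for n d
    using that by (induction n) (auto simp: Fp pD)
  have Forb: "?F ` orbit ?p d = orbit ?p (?F d)" if "d \<in> ?D" for d
  proof -
    have "?F ` orbit ?p d = {?F ((?p ^^ n) d) | n. 0 < n}"
      by (simp add: orbit_altdef setcompr_eq_image image_image)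
    then show ?thesis using Fpn[OF that] by (simp add: orbit_altdef)
  qed
  have FD3: "?F d \<in> ?D3" if "d \<in> ?D3" for d
    using that Fpn[of d 3] FD[of d] by auto
  have fin: "finite ?D3" using D(5) by simp
  have self: "d \<in> orbit ?p d" if "d \<in> ?D3" for d using trihex_face_orbit(1)[OF assms(1)] that by auto
  have card3: "card (orbit ?p d) = 3" if "d \<in> ?D3" for d
    using that funpow_eq_self_iff[OF self[OF that], of 3] trihex_face_orbit(2)[OF assms(1), of d] by auto
  have closed: "?p d \<in> ?D3" if "d \<in> ?D3" for d
    using that pD by (auto simp: funpow_3)
  have "(\<Sum>B\<in>orbit ?p ` ?D3. card B * 1) = (\<Sum>B\<in>orbit ?p ` ?D3. 3)"
    by (intro sum.cong refl) (use card3 in fastforce)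
  then have "card ?D3 = card (orbit ?p ` ?D3) * 3"
    using sum_over_orbits[OF fin self closed, of "\<lambda>_. 1"] by simp
  then have four: "card (orbit ?p ` ?D3) = 4" using trihex_card_triangle_darts[OF assms(1)] by simp
  have "\<exists>B\<in>orbit ?p ` ?D3. ?F ` B = B"
  proof (rule ccontr)
    assume no: "\<not> ?thesis"
    have "3 dvd card (orbit ?p ` ?D3)"
    proof (rule prime_dvd_card_if_no_fixpoint[where g = "image ?F"])
      fix B assume "B \<in> orbit ?p ` ?D3"
      then obtain d where d: "d \<in> ?D3" "B = orbit ?p d" by blast
      show "?F ` B \<in> orbit ?p ` ?D3" using d FD3 Forb by auto
      have "B \<subseteq> ?D" using d Fpn[of d] by (auto simp: orbit_altdef)
      then have "?F ` ?F ` ?F ` B = B" using F3 by (force simp: image_iff)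
      then show "(image ?F ^^ 3) B = B" by (simp add: funpow_3)
      show "?F ` B \<noteq> B" using no \<open>B \<in> orbit ?p ` ?D3\<close> by blast
    qed (use fin in auto)
    then show False using four by simp
  qed
  then obtain d where d: "d \<in> ?D3" "?F ` orbit ?p d = orbit ?p d" by blast
  have "?F d \<in> orbit ?p d" using self[OF d(1)] d(2) by blast
  moreover have "orbit ?p d = {(?p ^^ m) d | m. m < 3}"
    using d(1) by (intro orbit_altdef_bounded) auto
  ultimately obtain m where "m < 3" "?F d = (?p ^^ m) d" by auto
  then have "?F d \<in> {d, ?p d, ?p (?p d)}"
    by (auto simp: less_Suc_eq numeral_3_eq_3)
  then show thesis using that d(1) by blast
qed

text \<open>The label \<open>c l\<close> is the tail of the translate by \<open>l\<close> of a
  triangle dart \<open>d\<close>. As \<open>h\<close> fixes \<open>d\<close>, \<open>alpha_t\<close>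
  computes all neighbours of these tails, so by connectedness they are all vertices.\<close>

lemma symmetric_trihex_labelling:
  assumes M: "trihex M" and sym: "three_fold_symmetric M"
  obtains K c where "rotation_lattice K" "labelling K c M" "\<And>x y. (x, y) \<in> K \<Longrightarrow> even x \<and> even y"
proof -
  let ?D = "parcs (skeleton M)" and ?V = "pverts (skeleton M)"
  interpret trihex_action "rot M" prod.swap ?D using M by (rule trihex_action_darts)
  note D = trihexD[OF M]
  obtain f v0 where iso: "oriented_iso f M M" and v0: "v0 \<in> ?V" "f v0 \<noteq> v0"
    and f3: "\<And>v. v \<in> ?V \<Longrightarrow> f (f (f v)) = v"
    using sym by (auto simp: three_fold_symmetric_def funpow_3)
  let ?F = "map_prod f f"
  obtain d where d: "d \<in> ?D" and p3: "(face_succ M ^^ 3) d = d"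
    and Fd: "?F d \<in> {d, face_succ M d, face_succ M (face_succ M d)}"
    using three_fold_triangle[OF M iso f3] .
  \<comment> \<open>The cube of the face walk is \<open>h\<close>, so lying on a triangle means
    being fixed by \<open>h\<close>.\<close>
  have h: "h d = d" using p3 by (simp add: funpow_3 face_succ_def h_def)
  define c where "c l = fst (t l d)" for l
  define K where "K = {l. t l d = d}"
  have td: "t l d \<in> ?D" for l using d by simp
  have out: "out_arcs (skeleton M) (c l) = {t l d, rot M (t l d), rot M (rot M (t l d))}" for l
  proof -
    have "orbit (rot M) (t l d) = {(rot M ^^ m) (t l d) | m. m < 3}"
      by (intro orbit_altdef_bounded) (auto simp: funpow_3)
    also have "\<dots> = {t l d, rot M (t l d), rot M (rot M (t l d))}"
      by (force simp: less_Suc_eq numeral_3_eq_3)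
    finally show ?thesis using trihex_out_arcs(1)[OF M td[of l]] by (simp add: c_def)
  qed
  have arc: "t l d = dart c l 0" "rot M (t l d) = dart c l 1" "rot M (rot M (t l d)) = dart c l 2" for l
  proof -
    have fst: "fst (rot M (t l d)) = c l" "fst (rot M (rot M (t l d))) = c l" for l
    proof -
      have "rot M (t l d) \<in> out_arcs (skeleton M) (c l)" "rot M (rot M (t l d)) \<in> out_arcs (skeleton M) (c l)"
        using out by blast+
      then show "fst (rot M (t l d)) = c l" "fst (rot M (rot M (t l d))) = c l" by simp_all
    qed
    obtain x y where l: "l = (x, y)" by (cases l)
    have snd: "snd e = fst (prod.swap e)" for e :: "'a \<times> 'a" by simp
    show "t l d = dart c l 0"
      by (rule prod_eqI) (simp_all add: dart_def snd[of "t _ _"] l alpha_t[OF h] dir_def c_def del: swap_simp fst_swap)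
    show "rot M (t l d) = dart c l 1"
      by (rule prod_eqI) (simp_all add: fst dart_def snd[of "rot M _"] l alpha_t[OF h] dir_def del: swap_simp fst_swap)
    show "rot M (rot M (t l d)) = dart c l 2"
      by (rule prod_eqI) (simp_all add: fst dart_def snd[of "rot M _"] l alpha_t[OF h] dir_def del: swap_simp fst_swap)
  qed
  have out': "out_arcs (skeleton M) (c l) = {dart c l 0, dart c l 1, dart c l 2}" for l
    unfolding out unfolding arc(3) unfolding arc(2) unfolding arc(1) ..
  have rot: "rot M (dart c l i) = dart c l (Suc i)" for l i
  proof -
    have "i mod 3 = 0 \<or> i mod 3 = 1 \<or> i mod 3 = 2" by presburger
    moreover have "rot M (dart c l 2) = dart c l 0"
      unfolding arc(3)[symmetric] arc(1)[symmetric] by simp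
    ultimately show ?thesis
      using arc[of l] dart_mod[of i 0 c l] dart_mod[of i 1 c l] dart_mod[of i 2 c l]
        dart_mod[of "Suc i" 0 c l] dart_mod[of "Suc i" 1 c l] dart_mod[of "Suc i" 2 c l]
      by (auto simp: mod_Suc)
  qed
  have cV: "c l \<in> ?V" for l using td D(6) by (simp add: c_def)
  have adj: "w \<in> range c" if uw: "(u, w) \<in> ?D" "u \<in> range c" for u w
  proof -
    obtain l where "u = c l" using uw(2) by blast
    then have "(u, w) \<in> out_arcs (skeleton M) (c l)" using uw(1) by simp
    then show ?thesis unfolding out' by (auto simp: dart_def)
  qed
  have verts: "range c = ?V"
    by (rule connected_closed_eq[OF D(1,2), of "c 0"]) (use cV adj in auto)
  have arcs: "?D = (\<Union>l. range (dart c l))"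
  proof (intro equalityI subsetI)
    fix a assume a: "a \<in> ?D"
    then obtain l where "fst a = c l" using D(6)[OF a] verts by blast
    then have "a \<in> out_arcs (skeleton M) (c l)" using a by simp
    then show "a \<in> (\<Union>l. range (dart c l))" unfolding out' by blast
  next
    fix a assume "a \<in> (\<Union>l. range (dart c l))"
    then obtain l i where a: "a = dart c l i" by blast
    have "dart c l i \<in> ?D"
      by (induction i) (use td arc(1) in \<open>auto simp: rot[symmetric]\<close>)
    then show "a \<in> ?D" using a by simp
  qed
  have c_eq: "c l = c m \<longleftrightarrow> l - m \<in> K" for l m
  proof
    assume "c l = c m"
    \<comment> \<open>Two translates with the same tail differ by a turn about it;
      \<open>sigma_t_neq\<close> rules out the proper turns.\<close>
    then have "t m d \<in> {t l d, rot M (t l d), rot M (rot M (t l d))}"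
      using out[of l] out[of m] by auto
    then consider "t m d = t l d" | "rot M (t l d) = t m d" | "rot M (t m d) = t l d" by auto
    then show "l - m \<in> K"
      by cases (use sigma_t_neq[OF d] in \<open>auto simp: K_def simp flip: t_eq_iff\<close>)
  qed (simp add: K_def c_def flip: t_eq_iff)
  have lab: "labelling K c M"
    unfolding labelling_def using c_eq verts arcs rot by simp
  have Ft: "?F (t l d) = t l (?F d)" for l
    by (rule t_equivariant[OF trihex_action_darts[OF M] trihex_action_darts[OF M] _ _ d])
      (use iso in \<open>auto simp: oriented_iso_def\<close>)
  \<comment> \<open>\<open>?F\<close> commutes with translations, so fixing \<open>d\<close> it
    would fix every vertex, \<open>v0\<close> included.\<close>
  have "?F d \<noteq> d"
  proof
    assume "?F d = d"
    then have "f (c l) = c l" for l using arg_cong[OF Ft[of l], of fst] by (simp add: c_def)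
    moreover obtain l where "v0 = c l" using v0(1) verts by blast
    ultimately show False using v0(2) by simp
  qed
  \<comment> \<open>The source of invariance: \<open>K\<close> also fixes \<open>?F d\<close>, which
    lies one or two face steps from \<open>d\<close>, and undoing those steps rotates the
    vector.\<close>
  have Finv: "t l (?F d) = ?F d" if "l \<in> K" for l
    using that Ft[of l] by (simp add: K_def)
  have phi_fix: "t (x + y, - x) e = e" if "t (x, y) (face_succ M e) = face_succ M e" for x y e
    using that unfolding face_succ_def o_apply t_phi by (metis sigma3 alpha2)
  have add: "l - m \<in> K" if "l \<in> K" "m \<in> K" for l m
    using that t_eq_iff[of l d m] by (simp add: K_def)
  have zero: "(0, 0) \<in> K" by (simp add: K_def flip: zero_prod_def)
  have "rotation_lattice K"
  proof (unfold_locales, fact zero, fact add)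
    fix x y assume xy: "(x, y) \<in> K"
    from Fd \<open>?F d \<noteq> d\<close> consider "?F d = face_succ M d" | "?F d = face_succ M (face_succ M d)" by auto
    then show "(- x - y, x) \<in> K"
    proof cases
      case 1
      \<comment> \<open>One face step gives multiplication by
        \<open>\<zeta>\<^sup>-\<^sup>1\<close>, whose negative is the rotation of order 3.\<close>
      then have "(x + y, - x) \<in> K" using Finv[OF xy] phi_fix by (simp add: K_def)
      then show ?thesis using add[OF zero] by fastforce
    next
      case 2
      \<comment> \<open>Two face steps give multiplication by
        \<open>\<zeta>\<^sup>-\<^sup>2\<close>, the inverse of the required rotation of order 3, so
        it is applied twice.\<close>
      have sq: "(y', - x' - y') \<in> K" if "(x', y') \<in> K" for x' y'
        using phi_fix[OF phi_fix[OF Finv[OF that, unfolded 2]]] by (simp add: K_def)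
      show ?thesis using sq[OF sq[OF xy]] by simp
    qed
  qed
  moreover have "even x \<and> even y" if "(x, y) \<in> K" for x y
    using t_fixed_even[OF d h, of x y] that by (simp add: K_def)
  ultimately show thesis using that lab by blast
qed

section \<open>The trihex of a lattice\<close>

text \<open>The condition \<open>four\<close> is the index of \<open>K\<close> in its half; it is
  assumed for every centre \<open>(u, v)\<close> because the three dart directions need different
  ones. Evenness excludes loops and multiple edges.\<close>

locale lattice_graph = rotation_lattice K for K +
  fixes c :: "int \<times> int \<Rightarrow> 'a"
  assumes c_eq: "c l = c m \<longleftrightarrow> l - m \<in> K"
    and even_mem: "(x, y) \<in> K \<Longrightarrow> even x \<and> even y"
    and fin: "finite (range c)"
    and four: "card (c ` {(x, y). (2 * (x - u), 2 * (y - v)) \<in> K}) = 4"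
begin

definition darts :: "('a \<times> 'a) set" where
  "darts = (\<Union>l. range (dart c l))"

text \<open>A dart has many representations by \<open>l\<close> and \<open>i\<close>;
  \<open>next_dart_dart\<close> shows that the value does not depend on them. The identity elsewhere
  is demanded by \<open>permutes\<close>.\<close>

definition next_dart :: "'a \<times> 'a \<Rightarrow> 'a \<times> 'a" where
  "next_dart a = (if a \<in> darts then THE b. \<exists>l i. a = dart c l i \<and> b = dart c l (Suc i) else a)"

definition graph :: "'a embedded_graph" where
  "graph = \<lparr>skeleton = \<lparr>pverts = range c, parcs = darts\<rparr>, rot = next_dart\<rparr>"

lemma graph_simps [simp]:
  "pverts (skeleton graph) = range c" "parcs (skeleton graph) = darts" "rot graph = next_dart"
  by (simp_all add: graph_def)

lemma dart_in_darts [simp]: "dart c l i \<in> darts"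
  by (auto simp only: darts_def)

lemma dartsE:
  assumes "a \<in> darts" obtains l i where "a = dart c l i"
  using assms unfolding darts_def by blast

text \<open>Two distinct directions differ by a vector with an odd coordinate, which evenness keeps
  out of \<open>K\<close>; so the three neighbours of a vertex are distinct.\<close>

lemma dir_diff_mem: "dir i - dir j \<in> K \<longleftrightarrow> i mod 3 = j mod 3"
proof
  assume *: "dir i - dir j \<in> K"
  have "i mod 3 = 0 \<or> i mod 3 = 1 \<or> i mod 3 = 2" "j mod 3 = 0 \<or> j mod 3 = 1 \<or> j mod 3 = 2"
    by presburger+
  then show "i mod 3 = j mod 3"
    using * even_mem by (auto simp: dir_def dest!: even_mem)
next
  assume "i mod 3 = j mod 3"
  then have "dir i = dir j" by (rule dir_mod)
  then show "dir i - dir j \<in> K" using zero_mem by (simp add: zero_prod_def)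
qed

lemma dart_eq_iff: "dart c l i = dart c m j \<longleftrightarrow> l - m \<in> K \<and> i mod 3 = j mod 3"
proof -
  have eq: "dir i - l - (dir j - m) = (dir i - dir j) - (l - m)" by (simp add: algebra_simps)
  have "dir i - dir j \<in> K \<longleftrightarrow> (dir i - dir j) - (l - m) \<in> K" if "l - m \<in> K"
    using that diff_mem[of "dir i - dir j" "l - m"] add_mem[of "(dir i - dir j) - (l - m)" "l - m"] by auto
  then show ?thesis unfolding dart_def prod.inject c_eq eq dir_diff_mem[symmetric] by blast
qed

lemma dart_image_disjoint:
  assumes "i mod 3 \<noteq> j mod 3"
  shows "(\<lambda>l. dart c l i) ` A \<inter> (\<lambda>l. dart c l j) ` B = {}"
proof (rule equals0I)
  fix a assume "a \<in> (\<lambda>l. dart c l i) ` A \<inter> (\<lambda>l. dart c l j) ` B"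
  then obtain l m where "dart c l i = dart c m j" by (elim IntE imageE) metis
  then show False using assms by (simp add: dart_eq_iff)
qed

lemma next_dart_dart [simp]: "next_dart (dart c l i) = dart c l (Suc i)"
proof -
  have "(THE b. \<exists>m j. dart c l i = dart c m j \<and> b = dart c m (Suc j)) = dart c l (Suc i)"
  proof (rule the_equality)
    fix b assume "\<exists>m j. dart c l i = dart c m j \<and> b = dart c m (Suc j)"
    then obtain m j where "l - m \<in> K" "i mod 3 = j mod 3" "b = dart c m (Suc j)"
      by (auto simp only: dart_eq_iff)
    moreover from this have "Suc i mod 3 = Suc j mod 3" by (metis mod_Suc_eq)
    ultimately have "dart c l (Suc i) = b" by (simp only: dart_eq_iff)
    then show "b = dart c l (Suc i)" by simp
  qed blast
  then show ?thesis by (simp add: next_dart_def)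
qed

lemma next_dart_cube: "next_dart (next_dart (next_dart a)) = a"
proof (cases "a \<in> darts")
  case True
  then show ?thesis by (elim dartsE) (simp add: dart_mod[of "Suc (Suc (Suc _))"])
qed (simp add: next_dart_def)

lemma next_dart_permutes: "next_dart permutes darts"
  unfolding permutes_def
proof (intro conjI allI impI ex_ex1I)
  show "next_dart a = a" if "a \<notin> darts" for a using that by (simp add: next_dart_def)
  show "\<exists>x. next_dart x = y" for y using next_dart_cube by metis
  show "x = y" if "next_dart x = z" "next_dart y = z" for x y z using that next_dart_cube by metis
qed

lemma labelling_graph: "labelling K c graph"
  unfolding labelling_def by (simp add: c_eq darts_def)

lemma swap_in_darts: "a \<in> darts \<Longrightarrow> prod.swap a \<in> darts"
  by (elim dartsE) (simp add: swap_dart)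

text \<open>A loop would put \<open>dir i - 2 * l\<close> into \<open>K\<close>, but every
  \<open>dir i\<close> has an odd coordinate.\<close>

lemma swap_neq:
  assumes "a \<in> darts" shows "prod.swap a \<noteq> a"
proof
  assume "prod.swap a = a"
  moreover obtain x y i where "a = dart c (x, y) i" using assms by (metis dartsE surj_pair)
  ultimately have "dir i - (x, y) - (x, y) \<in> K" by (simp only: swap_dart dart_eq_iff)
  then show False
    by (auto simp: dir_def split: if_splits dest!: even_mem)
qed

lemma pair_graph_skeleton: "pair_graph (skeleton graph)"
proof
  show "finite (pverts (skeleton graph))" using fin by simp
  have "darts \<subseteq> range c \<times> range c" by (auto simp: darts_def dart_def)
  then show "finite (parcs (skeleton graph))" using fin by (auto intro: finite_subset)
  show "symmetric (with_proj (skeleton graph))"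
    using swap_in_darts by (force simp: symmetric_def sym_def)
  fix a assume a: "a \<in> parcs (skeleton graph)"
  then show "fst a \<in> pverts (skeleton graph)" "snd a \<in> pverts (skeleton graph)"
    by (auto simp: darts_def dart_def)
  show "fst a \<noteq> snd a" using swap_neq[of a] a by (cases a) auto
qed

lemma out_arcs_graph: "out_arcs (skeleton graph) (c l) = {dart c l 0, dart c l 1, dart c l 2}"
proof (intro equalityI subsetI)
  fix a assume "a \<in> out_arcs (skeleton graph) (c l)"
  then have "a \<in> darts" "fst a = c l" by simp_all
  then obtain m i where a: "a = dart c m i" "c m = c l" by (auto simp: dart_def elim!: dartsE)
  have "i mod 3 = 0 \<or> i mod 3 = 1 \<or> i mod 3 = 2" by presburger
  then show "a \<in> {dart c l 0, dart c l 1, dart c l 2}"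
    using a by (simp add: dart_eq_iff c_eq)
next
  have "fst (dart c l i) = c l" for i by (simp add: dart_def)
  moreover fix a assume "a \<in> {dart c l 0, dart c l 1, dart c l 2}"
  ultimately show "a \<in> out_arcs (skeleton graph) (c l)" by auto
qed

lemma orbit_next_dart: "orbit next_dart (dart c l 0) = {dart c l 0, dart c l 1, dart c l 2}"
proof -
  have "orbit next_dart (dart c l 0) = {(next_dart ^^ m) (dart c l 0) | m. m < 3}"
    by (rule orbit_altdef_bounded) (auto simp: funpow_3 next_dart_cube simp del: next_dart_dart)
  also have "\<dots> = {dart c l 0, dart c l 1, dart c l 2}"
    by (force simp: less_Suc_eq numeral_3_eq_3 numeral_2_eq_2)
  finally show ?thesis .
qed

lemma card_out_arcs_graph: "card {dart c l 0, dart c l 1, dart c l 2} = 3"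
  by (simp add: dart_eq_iff)

lemma rotation_system_graph: "rotation_system graph"
  unfolding rotation_system_def
proof (intro conjI ballI impI)
  show "rot graph permutes parcs (skeleton graph)" using next_dart_permutes by simp
  fix v assume "v \<in> pverts (skeleton graph)"
  then obtain l where v: "v = c l" by auto
  show "cyclic_on (rot graph) (out_arcs (skeleton graph) v)"
    unfolding v out_arcs_graph graph_simps cyclic_on_def
    using orbit_next_dart[of l] by blast
qed

lemma regular_graph: "regular 3 graph"
  unfolding regular_def out_degree_def
proof
  fix v assume "v \<in> pverts (skeleton graph)"
  then obtain l where v: "v = c l" by auto
  show "card (out_arcs (skeleton graph) v) = 3"
    unfolding v out_arcs_graph by (rule card_out_arcs_graph)
qed

text \<open>Two successive edges shift the label by \<open>dir j - dir i\<close>, and these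
  differences include all four unit steps.\<close>

lemma connected_graph: "Digraph_Component.connected (skeleton graph)"
proof -
  interpret pair_graph "skeleton graph" by (rule pair_graph_skeleton)
  have "c l \<rightarrow>\<^sup>*\<^bsub>with_proj (skeleton graph)\<^esub> c (dir i - l)" for l i
    using dart_in_darts[of l i] by (intro reachable_adjI) (simp add: dart_def)
  then have two: "c l \<rightarrow>\<^sup>*\<^bsub>with_proj (skeleton graph)\<^esub> c (dir j - (dir i - l))" for l i j
    using reachable_trans by blast
  have right: "c (x, y) \<rightarrow>\<^sup>*\<^bsub>with_proj (skeleton graph)\<^esub> c (x + 1, y)" for x y
    using two[of "(x, y)" 1 2] by (simp add: dir_def algebra_simps)
  have left: "c (x, y) \<rightarrow>\<^sup>*\<^bsub>with_proj (skeleton graph)\<^esub> c (x - 1, y)" for x y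
    using two[of "(x, y)" 2 1] by (simp add: dir_def algebra_simps)
  have up: "c (x, y) \<rightarrow>\<^sup>*\<^bsub>with_proj (skeleton graph)\<^esub> c (x, y + 1)" for x y
    using two[of "(x, y)" 1 0] by (simp add: dir_def algebra_simps)
  have down: "c (x, y) \<rightarrow>\<^sup>*\<^bsub>with_proj (skeleton graph)\<^esub> c (x, y - 1)" for x y
    using two[of "(x, y)" 0 1] by (simp add: dir_def algebra_simps)
  have "c (0, 0) \<rightarrow>\<^sup>*\<^bsub>with_proj (skeleton graph)\<^esub> c (x, 0)" for x
    by (induction x rule: int_induct[of _ 0]) (auto intro: reachable_trans right left)
  moreover have "c (x, 0) \<rightarrow>\<^sup>*\<^bsub>with_proj (skeleton graph)\<^esub> c (x, y)" for x y
    by (induction y rule: int_induct[of _ 0]) (auto intro: reachable_trans up down)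
  ultimately have "c (0, 0) \<rightarrow>\<^sup>*\<^bsub>with_proj (skeleton graph)\<^esub> c l" for l
    by (cases l) (blast intro: reachable_trans)
  then have "c l \<rightarrow>\<^sup>*\<^bsub>with_proj (skeleton graph)\<^esub> c m" for l m
    using symmetric_reachable[OF pair_sym_arcs] reachable_trans by blast
  then show ?thesis by (intro connectedI reachable_mk_symmetricI) auto
qed

section \<open>Faces and Euler characteristic of the lattice graph\<close>

lemma face_succ_dart: "face_succ graph (dart c l i) = dart c (dir i - l) (Suc i)"
  by (simp add: face_succ_def swap_dart)

text \<open>Three face steps keep the direction and reflect \<open>l\<close> in a point: this is the
  half turn about the face, so its square is the identity.\<close>

lemma face_succ_cube_dart:
  "(face_succ graph ^^ 3) (dart c l i) = dart c (dir (i + 2) - dir (i + 1) + dir i - l) i"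
proof -
  have "(face_succ graph ^^ 3) (dart c l i) = dart c (dir (i + 2) - (dir (i + 1) - (dir i - l))) (i + 3)"
    by (simp add: funpow_3 face_succ_dart numeral_2_eq_2 numeral_3_eq_3)
  also have "dir (i + 2) - (dir (i + 1) - (dir i - l)) = dir (i + 2) - dir (i + 1) + dir i - l"
    by (simp add: algebra_simps)
  finally show ?thesis by (simp add: dart_mod[of "i + 3" i])
qed

lemma face_orbit_graph:
  assumes "a \<in> darts"
  shows "a \<in> orbit (face_succ graph) a"
    "card (orbit (face_succ graph) a) = 3 \<or> card (orbit (face_succ graph) a) = 6"
proof -
  let ?p = "face_succ graph"
  obtain l i where a: "a = dart c l i" using assms by (rule dartsE)
  have "(?p ^^ 6) a = (?p ^^ 3) ((?p ^^ 3) a)" using funpow_add[of 3 3 ?p] by simp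
  also have "\<dots> = a" unfolding a face_succ_cube_dart by (simp add: algebra_simps)
  finally have p6: "(?p ^^ 6) a = a" .
  then show self: "a \<in> orbit ?p a" by (rule self_in_orbitI) simp
  \<comment> \<open>One or two face steps change the direction modulo 3.\<close>
  have "(?p ^^ 1) a \<noteq> a" "(?p ^^ 2) a \<noteq> a"
    by (auto simp: a numeral_2_eq_2 face_succ_dart dart_eq_iff mod_Suc split: if_splits)
  then have "card (orbit ?p a) dvd 6" "\<not> card (orbit ?p a) dvd 1" "\<not> card (orbit ?p a) dvd 2"
    using p6 unfolding funpow_eq_self_iff[OF self] by blast+
  moreover have divs: "k = 1 \<or> k = 2 \<or> k = 3 \<or> k = 6" if "k dvd 6" for k :: nat
  proof -
    have "k \<le> 6" "k \<noteq> 0" using that by (auto dest: dvd_imp_le intro!: Nat.gr0I)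
    then have "k \<in> {1, 2, 3, 4, 5, 6}" by auto
    then show ?thesis using that by auto
  qed
  ultimately show "card (orbit ?p a) = 3 \<or> card (orbit ?p a) = 6"
    using divs[of "card (orbit ?p a)"] by auto
qed

lemma card_triangle_darts_graph: "card {a \<in> darts. (face_succ graph ^^ 3) a = a} = 12"
proof -
  \<comment> \<open>Twice \<open>u i\<close> is \<open>dir (i + 2) - dir (i + 1) + dir i\<close>, so
    three face steps fix a dart of direction \<open>i\<close> exactly if
    \<open>2 * (l - u i)\<close> lies in \<open>K\<close>.\<close>
  define u where "u i = (if i = 0 then (0 :: int, 0) else if i = 1 then (1, 0) else (0, 1 :: int))" for i :: nat
  let ?S = "\<lambda>i. {(x, y). (2 * (x - fst (u i)), 2 * (y - snd (u i))) \<in> K}"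
  let ?T = "\<lambda>i. (\<lambda>l. dart c l i) ` ?S i"
  have fixed: "(face_succ graph ^^ 3) (dart c l i) = dart c l i \<longleftrightarrow> l \<in> ?S i" if i3: "i < 3" for l i
  proof -
    obtain x y where l: "l = (x, y)" by (cases l)
    have "dir (i + 2) - dir (i + 1) + dir i - l - l = - (2 * (x - fst (u i)), 2 * (y - snd (u i)))"
    proof -
      consider "i = 0" | "i = 1" | "i = 2" using i3 by linarith
      then show ?thesis by cases (simp_all add: l dir_def u_def)
    qed
    then have "dir (i + 2) - dir (i + 1) + dir i - l - l \<in> K \<longleftrightarrow>
        (2 * (x - fst (u i)), 2 * (y - snd (u i))) \<in> K"
      by (simp only: uminus_mem_iff)
    then show ?thesis unfolding face_succ_cube_dart dart_eq_iff by (simp only: l mem_Collect_eq case_prod_conv simp_thms)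
  qed
  have eq: "{a \<in> darts. (face_succ graph ^^ 3) a = a} = (\<Union>i\<in>{..<3}. ?T i)"
  proof (intro equalityI subsetI)
    fix a assume "a \<in> {a \<in> darts. (face_succ graph ^^ 3) a = a}"
    then have a: "a \<in> darts" "(face_succ graph ^^ 3) a = a" by auto
    obtain l j where "a = dart c l j" using a(1) by (rule dartsE)
    then have al: "a = dart c l (j mod 3)" using dart_mod[of j "j mod 3"] by simp
    then have "l \<in> ?S (j mod 3)" using a(2) fixed[of "j mod 3" l] by simp
    then show "a \<in> (\<Union>i\<in>{..<3}. ?T i)" using al by (intro UN_I[of "j mod 3"]) auto
  next
    fix a assume "a \<in> (\<Union>i\<in>{..<3}. ?T i)"
    then obtain i l where "i < 3" "l \<in> ?S i" "a = dart c l i" by blast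
    then show "a \<in> {a \<in> darts. (face_succ graph ^^ 3) a = a}" using fixed by simp
  qed
  have cardT: "card (?T i) = 4" for i
  proof -
    have "inj_on fst (?T i)"
    proof (rule inj_onI)
      fix a b assume "a \<in> ?T i" "b \<in> ?T i" and eq: "fst a = fst b"
      then obtain l m where ab: "a = dart c l i" "b = dart c m i" by blast
      then have "c l = c m" using eq by (simp add: dart_def)
      then show "a = b" unfolding ab dart_eq_iff c_eq by simp
    qed
    then have "card (?T i) = card (fst ` ?T i)" by (simp add: card_image)
    also have "fst ` ?T i = c ` ?S i" by (simp add: image_image dart_def)
    finally show ?thesis using four by simp
  qed
  have finT: "finite (?T i)" for i by (rule card_ge_0_finite) (simp only: cardT zero_less_numeral)
  have disj: "?T i \<inter> ?T j = {}" if "i < 3" "j < 3" "i \<noteq> j" for i j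
    by (rule dart_image_disjoint) (use that in simp)
  have "card (\<Union>i\<in>{..<3}. ?T i) = (\<Sum>i\<in>{..<3}. card (?T i))"
  proof (rule card_UN_disjoint)
    show "\<forall>i\<in>{..<3}. finite (?T i)" using finT by (intro ballI)
    show "\<forall>i\<in>{..<3}. \<forall>j\<in>{..<3}. i \<noteq> j \<longrightarrow> ?T i \<inter> ?T j = {}"
      using disj by (intro ballI impI) (simp only: lessThan_iff)
  qed simp
  then show ?thesis unfolding eq cardT by simp
qed

lemma trihex_graph: "trihex graph"
proof -
  interpret pair_graph "skeleton graph" by (rule pair_graph_skeleton)
  have fin_darts: "finite darts" using pair_finite_arcs by simp
  have "card (parcs (skeleton graph)) = 3 * card (pverts (skeleton graph))"
    by (rule card_darts) (use fin fin_darts arc_fst_in_verts regular_graph in auto)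
  moreover have "even (card (parcs (skeleton graph)))"
    by (rule even_card_darts) (use fin_darts swap_in_darts swap_neq in \<open>simp_all del: swap_simp\<close>)
  ultimately have "euler_char graph = 2 \<longleftrightarrow> card {d \<in> darts. (face_succ graph ^^ 3) d = d} = 12"
    using face_orbit_graph fin_darts
    by (subst euler_char_eq_2_iff) (auto simp: face_succ_dart elim: dartsE)
  then have "euler_char graph = 2" using card_triangle_darts_graph by blast
  then show ?thesis
    unfolding trihex_def plane_graph_def faces_def sides_def
    using pair_graph_skeleton connected_graph rotation_system_graph regular_graph face_orbit_graph by simp
qed

lemma three_fold_symmetric_graph: "three_fold_symmetric graph"
proof -
  \<comment> \<open>The rotation \<open>\<rho>\<close> of order 3 followed by the shift
    \<open>a = (1, 0)\<close>, which solves \<open>2 * a = dir (Suc i) - \<rho> (dir i)\<close> for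
    all \<open>i\<close>; this makes the map respect edges.\<close>
  define \<theta> :: "int \<times> int \<Rightarrow> int \<times> int" where "\<theta> = (\<lambda>(x, y). (1 - x - y, x))"
  have \<theta>3: "\<theta> (\<theta> (\<theta> l)) = l" for l by (cases l) (simp add: \<theta>_def)
  have \<theta>K: "\<theta> l - \<theta> m \<in> K" if "l - m \<in> K" for l m
  proof -
    obtain x y x' y' where lm: "l = (x, y)" "m = (x', y')" by (cases l; cases m)
    then have "(x - x', y - y') \<in> K" using that by simp
    from rho_mem[OF this] show ?thesis by (simp add: lm \<theta>_def algebra_simps)
  qed
  have \<theta>dir: "\<theta> (dir i - l) = dir (Suc i) - \<theta> l" for l i
    by (cases l) (auto simp: \<theta>_def dir_def mod_Suc)
  define f where "f v = c (\<theta> (SOME l. c l = v))" for v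
  have f: "f (c l) = c (\<theta> l)" for l
  proof -
    have "c (SOME m. c m = c l) = c l" by (rule someI) simp
    then have "(SOME m. c m = c l) - l \<in> K" by (simp only: c_eq)
    then show ?thesis unfolding f_def c_eq by (rule \<theta>K)
  qed
  have f3: "f (f (f (c l))) = c l" for l by (simp add: f \<theta>3)
  have dart: "map_prod f f (dart c l i) = dart c (\<theta> l) (Suc i)" for l i
    by (simp add: dart_def f \<theta>dir)
  have "oriented_iso f graph graph"
    unfolding oriented_iso_def graph_simps
  proof (intro conjI ballI)
    show "bij_betw f (range c) (range c)"
      by (rule bij_betw_byWitness[where f' = "f \<circ> f"]) (auto simp only: o_apply f \<theta>3 image_iff)
    show "map_prod f f ` darts = darts"
    proof (intro equalityI subsetI)
      fix a assume "a \<in> darts"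
      then obtain l i where "a = dart c l i" by (rule dartsE)
      then have "a = map_prod f f (dart c (\<theta> (\<theta> l)) (i + 2))"
        by (simp add: dart \<theta>3 dart_mod[of "Suc (Suc (Suc i))" i])
      then show "a \<in> map_prod f f ` darts" by (metis dart_in_darts image_eqI)
    next
      fix a assume "a \<in> map_prod f f ` darts"
      then show "a \<in> darts" by (auto simp only: dart dart_in_darts image_iff elim!: dartsE)
    qed
    fix a assume "a \<in> darts"
    then show "map_prod f f (next_dart a) = next_dart (map_prod f f a)"
      by (elim dartsE) (simp add: dart)
  qed
  moreover have "f (c (0, 0)) \<noteq> c (0, 0)"
    unfolding f c_eq using even_mem[of 1 0] by (auto simp: \<theta>_def)
  ultimately show ?thesis
    unfolding three_fold_symmetric_def using f3 by (intro exI[of _ f]) (auto simp: funpow_3)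
qed

end

lemma lattice_graph_hnf:
  assumes c: "\<And>l m. c l = c m \<longleftrightarrow> l - m \<in> hnf_lattice (2 * e) n b" and e: "e > 0" "n > 0"
    and b: "n dvd b\<^sup>2 + b + 1"
  shows "lattice_graph (hnf_lattice (2 * e) n b) c"
proof -
  interpret rotation_lattice "hnf_lattice (2 * e) n b" using b by (rule rotation_lattice_hnf)
  show ?thesis
  proof
    show "c l = c m \<longleftrightarrow> l - m \<in> hnf_lattice (2 * e) n b" for l m by (rule c)
    show "even x \<and> even y" if "(x, y) \<in> hnf_lattice (2 * e) n b" for x y
      using hnf_lattice_even_iff[of "2 * e" n b] that by auto
    show "finite (range c)" using card_range_hnf_lattice(1)[OF c] e by simp
    show "card (c ` {(x, y). (2 * (x - u), 2 * (y - v)) \<in> hnf_lattice (2 * e) n b}) = 4" for u v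
      using card_half_hnf_lattice[OF c e] .
  qed
qed

lemma num_symmetric_trihexes_eq:
  assumes "n > 0"
  shows "num_symmetric_trihexes (4 * n) = card (eisenstein_ideals n)"
proof -
  let ?T = "{M :: nat embedded_graph. trihex M \<and> card (pverts (skeleton M)) = 4 * n \<and> three_fold_symmetric M}"
  \<comment> \<open>Doubling \<open>e\<close> passes from the ideal \<open>I\<close> to the lattice
    \<open>K\<close> of its doubles.\<close>
  define L where "L = (\<lambda>(e, b). hnf_lattice (2 * e) (n div e\<^sup>2) b)"
  have idealsD: "e > 0 \<and> n div e\<^sup>2 > 0 \<and> e\<^sup>2 * (n div e\<^sup>2) = n \<and> b < n div e\<^sup>2 \<and> n div e\<^sup>2 dvd b\<^sup>2 + b + 1"
    if "(e, b) \<in> eisenstein_ideals n" for e b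
    using that assms by (auto simp: eisenstein_ideals_def cube_roots_def intro!: Nat.gr0I)
  have "\<forall>z\<in>eisenstein_ideals n. \<exists>M. M \<in> ?T \<and> (\<exists>c. labelling (L z) c M)"
  proof
    fix z assume z: "z \<in> eisenstein_ideals n"
    obtain e b where zeb: "z = (e, b)" by (cases z)
    let ?m = "n div e\<^sup>2"
    have eb: "e > 0" "?m > 0" "e\<^sup>2 * ?m = n" "b < ?m" "?m dvd b\<^sup>2 + b + 1"
      using idealsD z zeb by blast+
    interpret R: rotation_lattice "hnf_lattice (2 * e) ?m b" using eb(5) by (rule rotation_lattice_hnf)
    obtain c :: "int \<times> int \<Rightarrow> nat" where c: "\<And>l m. c l = c m \<longleftrightarrow> l - m \<in> hnf_lattice (2 * e) ?m b"
      using R.labelling_exists by blast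
    interpret G: lattice_graph "hnf_lattice (2 * e) ?m b" c using c eb(1,2,5) by (rule lattice_graph_hnf)
    have "card (range c) = 4 * n" using card_range_hnf_lattice(2)[OF c] eb by (simp add: power_mult_distrib)
    then have "G.graph \<in> ?T" using G.trihex_graph G.three_fold_symmetric_graph by simp
    moreover have "labelling (L z) c G.graph" using G.labelling_graph by (simp add: L_def zeb)
    ultimately show "\<exists>M. M \<in> ?T \<and> (\<exists>c. labelling (L z) c M)" by blast
  qed
  from bchoice[OF this] obtain M
    where M: "\<And>z. z \<in> eisenstein_ideals n \<Longrightarrow> M z \<in> ?T \<and> (\<exists>c. labelling (L z) c (M z))"
    by blast
  have rot: "rotation_lattice (L z)" if "z \<in> eisenstein_ideals n" for z
    using idealsD that by (cases z) (auto simp: L_def intro!: rotation_lattice_hnf)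
  have "?T // trihex_equiv = (\<lambda>z. trihex_equiv `` {M z}) ` eisenstein_ideals n"
  proof (intro equalityI subsetI)
    fix A assume "A \<in> ?T // trihex_equiv"
    then obtain N where N: "N \<in> ?T" "A = trihex_equiv `` {N}" by (rule quotientE)
    then have tN: "trihex N" "three_fold_symmetric N" "card (pverts (skeleton N)) = 4 * n" by auto
    obtain K c where K: "rotation_lattice K" "labelling K c N" "\<And>x y. (x, y) \<in> K \<Longrightarrow> even x \<and> even y"
      using symmetric_trihex_labelling[OF tN(1,2)] by blast
    interpret rotation_lattice K by fact
    have fin: "finite (range c)" using trihexD(4)[OF tN(1)] labellingD(2)[OF K(2)] by simp
    \<comment> \<open>Finitely many vertices force a nonzero vector of \<open>K\<close> on the first
      axis, as \<open>hnf_exists\<close> requires.\<close>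
    have "\<not> inj (\<lambda>x :: int. c (x, 0))"
    proof
      assume "inj (\<lambda>x :: int. c (x, 0))"
      then have "infinite (range (\<lambda>x :: int. c (x, 0)))" by (simp add: finite_image_iff)
      moreover have "range (\<lambda>x :: int. c (x, 0)) \<subseteq> range c" by blast
      ultimately show False using fin finite_subset by blast
    qed
    then obtain x x' where "x \<noteq> x'" "c (x, 0) = c (x', 0)" by (auto simp: inj_def)
    then have "(x - x', 0) \<in> K" "x - x' \<noteq> 0" using labellingD(1)[OF K(2)] by auto
    then obtain e' m b where hnf: "e' > 0" "b < m" "m dvd b\<^sup>2 + b + 1" "K = hnf_lattice e' m b"
      by (rule hnf_exists)
    have "even e'" using K(3) hnf_lattice_even_iff[of e' m b] hnf by auto
    then obtain e where e: "e' = 2 * e" by blast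
    have "card (range c) = e'\<^sup>2 * m"
      using labellingD(1)[OF K(2)] hnf by (intro card_range_hnf_lattice(2)) auto
    \<comment> \<open>The index of \<open>K\<close> is \<open>(2 * e)\<^sup>2 * m\<close>; halving
      the even lattice is what divides the number of vertices by 4.\<close>
    then have "4 * n = 4 * (e\<^sup>2 * m)" using tN(3) labellingD(2)[OF K(2)] e by (simp add: power_mult_distrib)
    then have n: "n = e\<^sup>2 * m" by simp
    have "e > 0" using hnf(1) e by simp
    then have m: "n div e\<^sup>2 = m" using n by simp
    have z: "(e, b) \<in> eisenstein_ideals n"
      using n m hnf by (auto simp: eisenstein_ideals_def cube_roots_def)
    have "L (e, b) = K" using hnf e m by (simp add: L_def)
    then obtain c' where "labelling K c' (M (e, b))" using M[OF z] by auto
    then obtain f where "oriented_iso f (M (e, b)) N" using labelling_iso K(2) by blast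
    then have "(M (e, b), N) \<in> trihex_equiv" using M[OF z] tN by (auto simp: trihex_equiv_def)
    then have "A = trihex_equiv `` {M (e, b)}"
      using N(2) equiv_class_eq[OF equiv_trihex_equiv] by blast
    then show "A \<in> (\<lambda>z. trihex_equiv `` {M z}) ` eisenstein_ideals n" using z by blast
  next
    fix A assume "A \<in> (\<lambda>z. trihex_equiv `` {M z}) ` eisenstein_ideals n"
    then obtain z where "z \<in> eisenstein_ideals n" "A = trihex_equiv `` {M z}" by blast
    then show "A \<in> ?T // trihex_equiv" using M quotientI by metis
  qed
  moreover have "inj_on (\<lambda>z. trihex_equiv `` {M z}) (eisenstein_ideals n)"
  proof (rule inj_onI)
    fix z z' assume z: "z \<in> eisenstein_ideals n" "z' \<in> eisenstein_ideals n"
      and eq: "trihex_equiv `` {M z} = trihex_equiv `` {M z'}"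
    have tri: "trihex (M z)" "trihex (M z')" using M[OF z(1)] M[OF z(2)] by auto
    have "(M z, M z') \<in> trihex_equiv"
      using eq_equiv_class[OF eq equiv_trihex_equiv] tri by simp
    then obtain f where "oriented_iso f (M z) (M z')" by (auto simp: trihex_equiv_def)
    moreover obtain c c' where "labelling (L z) c (M z)" "labelling (L z') c' (M z')"
      using M[OF z(1)] M[OF z(2)] by blast
    ultimately have "L z = L z'"
      using iso_same_lattice[OF tri(1) _ rot[OF z(1)] tri(2) _ rot[OF z(2)]] by blast
    then show "z = z'"
      using idealsD[of "fst z" "snd z"] idealsD[of "fst z'" "snd z'"] z
        hnf_lattice_inject[of "2 * fst z" "n div (fst z)\<^sup>2" "snd z" "2 * fst z'" "n div (fst z')\<^sup>2" "snd z'"]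
      by (simp add: L_def case_prod_beta prod_eq_iff)
  qed
  ultimately show ?thesis unfolding num_symmetric_trihexes_def by (simp add: card_image)
qed

theorem theorem11:
  fixes V m r s :: nat and p k q l :: "nat \<Rightarrow> nat"
  assumes "V > 0" and "4 dvd V"
    and "V div 4 = 3 ^ m * (\<Prod>i=1..r. p i ^ k i) * (\<Prod>j=1..s. q j ^ l j)"
    and "inj_on p {1..r}"
    and "\<And>i. i \<in> {1..r} \<Longrightarrow> prime (p i) \<and> p i mod 3 = 1 \<and> k i \<ge> 1"
    and "inj_on q {1..s}"
    and "\<And>j. j \<in> {1..s} \<Longrightarrow> prime (q j) \<and> q j mod 3 = 2 \<and> l j \<ge> 1"
  shows "((\<exists>j\<in>{1..s}. odd (l j)) \<longrightarrow> num_symmetric_trihexes V = 0) \<and>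
    ((\<forall>j\<in>{1..s}. even (l j)) \<longrightarrow> num_symmetric_trihexes V = (\<Prod>i=1..r. k i + 1))"
proof -
  have "V div 4 > 0" using assms(1,2) by (auto simp: dvd_div_eq_0_iff)
  then have "num_symmetric_trihexes (4 * (V div 4)) = card (eisenstein_ideals (V div 4))"
    by (rule num_symmetric_trihexes_eq)
  then have "num_symmetric_trihexes V = card (eisenstein_ideals (V div 4))"
    using assms(2) by simp
  also have "\<dots> = (\<Prod>i=1..r. k i + 1) * (\<Prod>j=1..s. if even (l j) then 1 else 0)"
    using assms(5,7) by (intro card_eisenstein_ideals_factorization[OF assms(3,4) _ assms(6)]) blast+
  finally show ?thesis by (auto simp: prod_zero_iff)
qed

end
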